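(* For every doubled pattern $p$, $GR_3(p)\ge GR_3(AA)$; that is, the growth rate of the language of ternary words avoiding $p$ is at least the growth rate of the language of ternary square-free words.
   Context: A (classical) pattern is a non-empty finite word $p$ over an alphabet $\Delta$ of variables; it is doubled if every variable occurring in $p$ occurs at least twice. A finite word $w$ over an alphabet $\Sigma$ avoids $p$ if there is no non-erasing morphism $h:\Delta^*\to\Sigma^*$ (i.e. $h(X)$ non-empty for every variable $X$) such that $h(p)$ is a factor of $w$. For a factorial language $L$ over $\Sigma$, let $f(n)=|L\cap\Sigma^n|$; the growth rate of $L$ is $\lim_{n\to\infty}f(n)^{1/n}$. $GR_3(p)$ denotes the growth rate of the language of words over a $3$-letter alphabet that avoid $p$. In particular $GR_3(AA)$ is the growth rate of ternary square-free words (words with no factor $uu$, $u$ non-empty). *)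

theory Defs
  imports "HOL-Analysis.Analysis" "HOL-Library.Sublist"
begin

definition doubled :: "'v list \<Rightarrow> bool" where
  "doubled p \<longleftrightarrow> (\<forall>X\<in>set p. count_list p X \<ge> 2)"

definition nonerasing_morphism :: "'a set \<Rightarrow> ('v list \<Rightarrow> 'a list) \<Rightarrow> bool" where
  "nonerasing_morphism \<Sigma> h \<longleftrightarrow>
     (\<forall>u. h u \<in> lists \<Sigma>) \<and> (\<forall>u v. h (u @ v) = h u @ h v) \<and> (\<forall>X. h [X] \<noteq> [])"

definition avoids :: "'a set \<Rightarrow> 'v list \<Rightarrow> 'a list \<Rightarrow> bool" where
  "avoids \<Sigma> p w \<longleftrightarrow> \<not> (\<exists>h. nonerasing_morphism \<Sigma> h \<and> sublist (h p) w)"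

definition avoiding_words :: "'a set \<Rightarrow> 'v list \<Rightarrow> 'a list set" where
  "avoiding_words \<Sigma> p = {w \<in> lists \<Sigma>. avoids \<Sigma> p w}"

definition factorial_language :: "'a list set \<Rightarrow> bool" where
  "factorial_language L \<longleftrightarrow> (\<forall>w\<in>L. \<forall>u. sublist u w \<longrightarrow> u \<in> L)"

definition growth_fun :: "'a set \<Rightarrow> 'a list set \<Rightarrow> nat \<Rightarrow> nat" where
  "growth_fun \<Sigma> L n = card (L \<inter> {w \<in> lists \<Sigma>. length w = n})"

text \<open>The operator \<^const>\<open>lim\<close> is total; that the limit really exists for factorial languages over
  a finite alphabet is the lemma \<open>growth_rate_LIMSEQ\<close> below.\<close>

definition growth_rate :: "'a set \<Rightarrow> 'a list set \<Rightarrow> real" where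
  "growth_rate \<Sigma> L = lim (\<lambda>n. root n (real (growth_fun \<Sigma> L n)))"

definition GR :: "nat \<Rightarrow> 'v list \<Rightarrow> real" where
  "GR k p = growth_rate {..<k} (avoiding_words {..<k} p)"

lemma factorial_avoiding_words: "factorial_language (avoiding_words \<Sigma> p)"
  unfolding factorial_language_def avoiding_words_def avoids_def
proof (intro ballI allI impI)
  fix w u assume w: "w \<in> {w \<in> lists \<Sigma>. \<not> (\<exists>h. nonerasing_morphism \<Sigma> h \<and> sublist (h p) w)}"
    and u: "sublist u w"
  have "u \<in> lists \<Sigma>" using w set_mono_sublist[OF u] by auto
  moreover have "\<not> (\<exists>h. nonerasing_morphism \<Sigma> h \<and> sublist (h p) u)"
    using w u by (blast intro: sublist_order.order_trans)
  ultimately show "u \<in> {w \<in> lists \<Sigma>. \<not> (\<exists>h. nonerasing_morphism \<Sigma> h \<and> sublist (h p) w)}"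
    by blast
qed

lemma growth_fun_add_le:
  assumes L: "factorial_language L" and fin: "finite \<Sigma>"
  shows "growth_fun \<Sigma> L (m + n) \<le> growth_fun \<Sigma> L m * growth_fun \<Sigma> L n"
proof -
  define W where "W k = L \<inter> {w \<in> lists \<Sigma>. length w = k}" for k
  have finW: "finite (W k)" for k
    by (rule finite_subset[OF _ finite_lists_length_eq[OF fin, of k]]) (auto simp: W_def)
  have "(\<lambda>w. (take m w, drop m w)) ` W (m + n) \<subseteq> W m \<times> W n"
    using L unfolding factorial_language_def W_def
    by (auto dest: in_set_takeD in_set_dropD)
  moreover have "inj_on (\<lambda>w. (take m w, drop m w)) (W (m + n))"
    by (rule inj_onI) (metis append_take_drop_id prod.inject)
  ultimately have "card (W (m + n)) \<le> card (W m \<times> W n)"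
    using card_inj_on_le finW by blast
  then show ?thesis by (simp add: growth_fun_def W_def card_cartesian_product)
qed

lemma subadditive_div_convergent:
  fixes b :: "nat \<Rightarrow> real"
  assumes nonneg: "\<And>n. b n \<ge> 0" and sub: "\<And>m n. b (m + n) \<le> b m + b n"
  shows "convergent (\<lambda>n. b n / n)"
proof -
  define l where "l = (INF n\<in>{1..}. b n / real n)"
  have bdd: "bdd_below ((\<lambda>n. b n / real n) ` {1..})"
    by (rule bdd_belowI[of _ 0]) (auto simp: nonneg)
  have lower: "l \<le> b n / real n" if "n \<ge> 1" for n
    unfolding l_def using that bdd by (intro cINF_lower) auto
  have mult: "b (q * m + r) \<le> real q * b m + b r" for q m r
  proof (induction q)
    case (Suc q)
    have "b (Suc q * m + r) \<le> b m + b (q * m + r)"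
      using sub[of m "q * m + r"] by (simp add: algebra_simps)
    with Suc show ?case by (simp add: algebra_simps)
  qed simp
  have "(\<lambda>n. b n / real n) \<longlonglongrightarrow> l"
  proof (rule order_tendstoI)
    fix a assume "a < l"
    then show "\<forall>\<^sub>F n in sequentially. a < b n / real n"
      using lower by (intro eventually_sequentiallyI[of 1]) (meson less_le_trans)
  next
    fix a assume a: "l < a"
    then obtain m where m: "m \<ge> 1" "b m / real m < a"
      unfolding l_def using cINF_less_iff[OF _ bdd, of a] by auto
    define C where "C = (\<Sum>r<m. b r)"
    have C: "b r \<le> C" if "r < m" for r
      unfolding C_def using that nonneg by (intro member_le_sum) auto
    have "(\<lambda>n. b m / real m + C / real n) \<longlonglongrightarrow> b m / real m + 0"
      by (intro tendsto_intros lim_const_over_n)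
    then have "\<forall>\<^sub>F n in sequentially. b m / real m + C / real n < a"
      using m(2) by (auto dest: order_tendstoD(2))
    then show "\<forall>\<^sub>F n in sequentially. b n / real n < a"
      using eventually_ge_at_top[of 1]
    proof eventually_elim
      case (elim n)
      have "b n \<le> real (n div m) * b m + b (n mod m)"
        using mult[of "n div m" m "n mod m"] by simp
      also have "\<dots> \<le> (real n / real m) * b m + C"
        using m(1) by (intro add_mono mult_right_mono C nonneg of_nat_div_le_of_nat) auto
      finally have "b n / real n \<le> ((real n / real m) * b m + C) / real n"
        by (rule divide_right_mono) simp
      also have "\<dots> = b m / real m + C / real n"
        using elim m(1) by (simp add: field_simps)
      finally show ?case using elim by linarith
    qed
  qed
  then show ?thesis by (rule convergentI)
qed

lemma growth_rate_LIMSEQ: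
  assumes L: "factorial_language L" and fin: "finite \<Sigma>"
  shows "(\<lambda>n. root n (real (growth_fun \<Sigma> L n))) \<longlonglongrightarrow> growth_rate \<Sigma> L"
proof -
  let ?f = "growth_fun \<Sigma> L"
  have sub: "?f (m + n) \<le> ?f m * ?f n" for m n
    using growth_fun_add_le[OF assms] .
  have "convergent (\<lambda>n. root n (real (?f n)))"
  proof (cases "\<exists>N. ?f N = 0")
    case True
    then obtain N where N: "?f N = 0" by blast
    have "?f n = 0" if "n \<ge> N" for n
      using sub[of N "n - N"] N that by simp
    then have "\<forall>\<^sub>F n in sequentially. root n (real (?f n)) = 0"
      by (intro eventually_sequentiallyI[of N]) simp
    then have "(\<lambda>n. root n (real (?f n))) \<longlonglongrightarrow> 0"
      by (rule tendsto_eventually)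
    then show ?thesis by (rule convergentI)
  next
    case False
    then have pos: "?f n \<ge> 1" for n by (simp add: Suc_le_eq)
    have "convergent (\<lambda>n. ln (real (?f n)) / real n)"
    proof (rule subadditive_div_convergent)
      show "0 \<le> ln (real (?f n))" for n using pos[of n] by simp
      fix m n
      have "ln (real (?f (m + n))) \<le> ln (real (?f m) * real (?f n))"
        using pos[of "m + n"] sub[of m n] pos[of m] pos[of n]
        by (subst ln_le_cancel_iff) (simp_all flip: of_nat_mult)
      also have "\<dots> = ln (real (?f m)) + ln (real (?f n))"
        using pos[of m] pos[of n] by (intro ln_mult_pos) auto
      finally show "ln (real (?f (m + n))) \<le> ln (real (?f m)) + ln (real (?f n))" .
    qed
    then obtain c where "(\<lambda>n. ln (real (?f n)) / real n) \<longlonglongrightarrow> c"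
      by (auto simp: convergent_def)
    then have "(\<lambda>n. exp (ln (real (?f n)) / real n)) \<longlonglongrightarrow> exp c"
      by (rule tendsto_exp)
    moreover have "\<forall>\<^sub>F n in sequentially. exp (ln (real (?f n)) / real n) = root n (real (?f n))"
    proof (rule eventually_sequentiallyI[of 1])
      fix n :: nat assume "1 \<le> n"
      then show "exp (ln (real (?f n)) / real n) = root n (real (?f n))"
        using pos[of n] by (simp add: root_powr_inverse powr_def)
    qed
    ultimately have "(\<lambda>n. root n (real (?f n))) \<longlonglongrightarrow> exp c"
      by (rule Lim_transform_eventually)
    then show ?thesis by (rule convergentI)
  qed
  then show ?thesis unfolding growth_rate_def by (simp add: convergent_LIMSEQ_iff)
qed

lemma avoids_AA_iff:
  assumes "w \<in> lists \<Sigma>"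
  shows "avoids \<Sigma> [A, A] w \<longleftrightarrow> \<not> (\<exists>u. u \<noteq> [] \<and> sublist (u @ u) w)"
proof -
  have "(\<exists>h. nonerasing_morphism \<Sigma> h \<and> sublist (h [A, A]) w)"
    if "u \<noteq> []" "sublist (u @ u) w" for u
  proof -
    have "set u \<subseteq> \<Sigma>" using set_mono_sublist[OF that(2)] assms by auto
    then have "nonerasing_morphism \<Sigma> (\<lambda>v. concat (map (\<lambda>_. u) v))"
      using that(1) by (auto simp: nonerasing_morphism_def split: if_splits)
    then show ?thesis using that(2) by (intro exI[of _ "\<lambda>v. concat (map (\<lambda>_. u) v)"]) simp
  qed
  moreover have "\<exists>u. u \<noteq> [] \<and> sublist (u @ u) w"
    if "nonerasing_morphism \<Sigma> h" "sublist (h [A, A]) w" for h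
  proof -
    have "h [A, A] = h [A] @ h [A]" "h [A] \<noteq> []"
      using that(1) unfolding nonerasing_morphism_def by (metis append_Cons append_Nil)+
    with that(2) show ?thesis by auto
  qed
  ultimately show ?thesis unfolding avoids_def by blast
qed

end

theory Submission
  imports Defs
begin

text \<open>A pattern containing a square is avoided by all square-free words, so let \<open>p\<close> be a square-free
  doubled pattern. Its avoiding words are counted by Rosenfeld's method. Words grow on the left by
  one letter; if the extended word contains \<open>p\<close>, then an occurrence \<open>h p\<close> is a prefix. Deleting from
  it everything but the image of a suffix of \<open>p\<close> loses little information, because every variable
  occurs twice. Hence the number of bad extensions is at most a weighted sum, over the possible
  lengths of the images, of numbers of shorter avoiding words, and a lower bound on the growth
  propagates by induction.

  If all three letters are allowed everywhere, this works for patterns with at least six variables,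
  for patterns with a variable that occurs three times, and for patterns whose last variables are
  distinct. Up to renaming, reversal and substitution, twelve patterns with three to five
  variables are left. For these the letters are restricted periodically with period 14: three of the
  positions carry the letter 0, the other eleven carry 1 or 2. An occurrence of \<open>p\<close> then projects to an
  occurrence in a periodic binary word, which leaves so few possible lengths that the weighted sum
  can be enumerated. All growth rates obtained are at least 1.58, while 342 square-free ternary
  words of length 13 give an upper bound of 1.58 for the square-free words.\<close>

subsection \<open>Occurrences and growth rates\<close>

definition occurs :: "'v list \<Rightarrow> 'a list \<Rightarrow> bool" where
  "occurs p w \<longleftrightarrow> (\<exists>f. (\<forall>X\<in>set p. f X \<noteq> []) \<and> sublist (concat (map f p)) w)"

text \<open>A morphism is determined by the images of single variables. Conversely, the images used
  in an occurrence are factors of \<open>w\<close>, hence words over \<open>\<Sigma>\<close>, so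
  \<open>occurs\<close> can do without an alphabet.\<close>

lemma avoids_iff_not_occurs:
  assumes p: "p \<noteq> []" and w: "w \<in> lists \<Sigma>"
  shows "avoids \<Sigma> p w \<longleftrightarrow> \<not> occurs p w"
proof -
  have "occurs p w" if "nonerasing_morphism \<Sigma> h" "sublist (h p) w" for h
  proof -
    have app: "h (u @ v) = h u @ h v" and ne: "h [X] \<noteq> []" for u v X
      using that(1) by (auto simp: nonerasing_morphism_def)
    have nil: "h [] = []" using app[of "[]" "[]"] by simp
    have "h u = concat (map (\<lambda>X. h [X]) u)" for u
    proof (induction u)
      case (Cons X u)
      then show ?case using app[of "[X]" u] by simp
    qed (simp add: nil)
    with that(2) ne show ?thesis unfolding occurs_def by (metis (no_types, lifting))
  qed
  moreover have "\<exists>h. nonerasing_morphism \<Sigma> h \<and> sublist (h p) w"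
    if ne: "\<forall>X\<in>set p. f X \<noteq> []" and s: "sublist (concat (map f p)) w" for f
  proof -
    \<comment> \<open>A morphism must be non-erasing on every variable of the type; those outside
      \<open>p\<close> borrow the image of \<open>hd p\<close>.\<close>
    define g where "g X = (if X \<in> set p then f X else f (hd p))" for X
    have "set (f X) \<subseteq> \<Sigma>" if "X \<in> set p" for X
      using set_mono_sublist[OF s] w that by auto
    then have g: "set (g X) \<subseteq> \<Sigma>" "g X \<noteq> []" for X
      using p ne by (auto simp: g_def split: if_splits)
    have "nonerasing_morphism \<Sigma> (\<lambda>u. concat (map g u))"
      using g by (fastforce simp: nonerasing_morphism_def)
    moreover have "sublist (concat (map g p)) w"
      using s by (simp add: g_def cong: map_cong)
    ultimately show ?thesis by (intro exI[of _ "\<lambda>u. concat (map g u)"]) simp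
  qed
  ultimately show ?thesis unfolding avoids_def occurs_def by blast
qed

lemma avoiding_words_eq: "p \<noteq> [] \<Longrightarrow> avoiding_words \<Sigma> p = {w \<in> lists \<Sigma>. \<not> occurs p w}"
  by (simp add: avoiding_words_def avoids_iff_not_occurs cong: conj_cong)

section \<open>Substitution, renaming and reversal of patterns\<close>

lemma occurs_subst:
  assumes "occurs (x @ concat (map \<sigma> q) @ y) w" and "\<And>X. X \<in> set q \<Longrightarrow> \<sigma> X \<noteq> []"
  shows "occurs q w"
proof -
  obtain f where f: "\<forall>X\<in>set (x @ concat (map \<sigma> q) @ y). f X \<noteq> []"
    and s: "sublist (concat (map f (x @ concat (map \<sigma> q) @ y))) w"
    using assms(1) unfolding occurs_def by blast
  have *: "concat (map f (concat (map \<sigma> q))) = concat (map (\<lambda>X. concat (map f (\<sigma> X))) q)"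
    by (induction q) auto
  have "sublist (concat (map (\<lambda>X. concat (map f (\<sigma> X))) q)) w"
    using s unfolding * [symmetric] sublist_def by (auto, metis append.assoc)
  moreover have "concat (map f (\<sigma> X)) \<noteq> []" if "X \<in> set q" for X
  proof -
    have "hd (\<sigma> X) \<in> set (\<sigma> X)" using assms(2)[OF that] by simp
    then have "f (hd (\<sigma> X)) \<noteq> []" using f that by auto
    with \<open>hd (\<sigma> X) \<in> set (\<sigma> X)\<close> show ?thesis by auto
  qed
  ultimately show ?thesis
    unfolding occurs_def by (intro exI[of _ "\<lambda>X. concat (map f (\<sigma> X))"] conjI ballI)
qed

lemma occurs_rev: "occurs (rev p) (rev w) \<longleftrightarrow> occurs p w"
proof -
  have *: "occurs (rev p) (rev w)" if "occurs p w" for p :: "'a list" and w :: "'b list"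
  proof -
    obtain f where f: "\<forall>X\<in>set p. f X \<noteq> []" and s: "sublist (concat (map f p)) w"
      using \<open>occurs p w\<close> unfolding occurs_def by blast
    have "sublist (rev (concat (map f p))) (rev w)" using s by (simp add: sublist_rev)
    moreover have "rev (concat (map f p)) = concat (map (rev \<circ> f) (rev p))"
      by (simp add: rev_concat rev_map)
    ultimately show ?thesis using f unfolding occurs_def by (intro exI[of _ "rev \<circ> f"]) auto
  qed
  show ?thesis using *[of p w] *[of "rev p" "rev w"] by auto
qed

lemma finite_lists_of_length: "finite \<Sigma> \<Longrightarrow> finite (L \<inter> {w \<in> lists \<Sigma>. length w = n})"
  by (rule finite_subset[OF _ finite_lists_length_eq[where n = n]]) (auto simp: in_lists_conv_set)

lemma GR_LIMSEQ:
  "(\<lambda>n. root n (real (growth_fun {..<k} (avoiding_words {..<k} p) n))) \<longlonglongrightarrow> GR k p"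
  unfolding GR_def by (rule growth_rate_LIMSEQ[OF factorial_avoiding_words]) simp

lemma GR_mono:
  assumes "avoiding_words {..<k} q \<subseteq> avoiding_words {..<k} p"
  shows "GR k q \<le> GR k p"
proof (rule LIMSEQ_le[OF GR_LIMSEQ GR_LIMSEQ], intro exI[of _ 1] allI impI)
  fix n :: nat assume "n \<ge> 1"
  have "growth_fun {..<k} (avoiding_words {..<k} q) n
      \<le> growth_fun {..<k} (avoiding_words {..<k} p) n"
    unfolding growth_fun_def using assms by (intro card_mono finite_lists_of_length) auto
  then show "root n (growth_fun {..<k} (avoiding_words {..<k} q) n)
      \<le> root n (growth_fun {..<k} (avoiding_words {..<k} p) n)"
    using \<open>n \<ge> 1\<close> by simp
qed

text \<open>Composing an occurrence of \<open>p\<close> with \<open>\<sigma>\<close> yields an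
  occurrence of \<open>q\<close>, so every word avoiding \<open>q\<close> avoids
  \<open>p\<close>.\<close>

lemma GR_subst_le:
  assumes p: "p = x @ concat (map \<sigma> q) @ y" and q: "q \<noteq> []" and ne: "\<And>X. X \<in> set q \<Longrightarrow> \<sigma> X \<noteq> []"
  shows "GR k q \<le> GR k p"
proof (rule GR_mono)
  have "\<sigma> (hd q) \<noteq> []" "hd q \<in> set q" using ne q by simp_all
  then have "p \<noteq> []" unfolding p by auto
  then show "avoiding_words {..<k} q \<subseteq> avoiding_words {..<k} p"
    unfolding avoiding_words_eq[OF q] avoiding_words_eq[OF \<open>p \<noteq> []\<close>]
    using occurs_subst[of x \<sigma> q y, folded p, OF _ ne] by blast
qed

lemma GR_map_le: "q \<noteq> [] \<Longrightarrow> GR k q \<le> GR k (map r q)"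
  by (rule GR_subst_le[of _ "[]" "\<lambda>X. [r X]" _ "[]"]) simp_all

lemma GR_rev: assumes "p \<noteq> []" shows "GR k (rev p) = GR k p"
proof -
  have "growth_fun {..<k} (avoiding_words {..<k} (rev p)) n
      = growth_fun {..<k} (avoiding_words {..<k} p) n" for n
  proof -
    have "rev ` {w \<in> lists {..<k}. \<not> occurs p w \<and> length w = n}
        = {w \<in> lists {..<k}. \<not> occurs (rev p) w \<and> length w = n}" (is "rev ` ?A = ?B")
    proof
      show "rev ` ?A \<subseteq> ?B" using occurs_rev[of p] by auto
      show "?B \<subseteq> rev ` ?A"
      proof
        fix w assume "w \<in> ?B"
        then have "rev w \<in> ?A" using occurs_rev[of p "rev w"] by auto
        then have "rev (rev w) \<in> rev ` ?A" by (rule imageI)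
        then show "w \<in> rev ` ?A" by simp
      qed
    qed
    then have card: "card ?B = card ?A" using card_image[OF inj_on_rev, of ?A] by simp
    have *: "{w \<in> lists {..<k}. \<not> occurs q w} \<inter> {w \<in> lists {..<k}. length w = n}
        = {w \<in> lists {..<k}. \<not> occurs q w \<and> length w = n}" for q :: "'a list" by blast
    have "rev p \<noteq> []" using assms by simp
    show ?thesis
      unfolding growth_fun_def avoiding_words_eq[OF assms] avoiding_words_eq[OF \<open>rev p \<noteq> []\<close>] *
      by (rule card)
  qed
  then show ?thesis by (simp add: GR_def growth_rate_def)
qed

lemma GR_square_le:
  assumes "sublist (u @ u) p" and "u \<noteq> []"
  shows "GR k [A, A] \<le> GR k p"
proof -
  obtain x y where "p = x @ (u @ u) @ y" using assms(1) by (auto simp: sublist_def)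
  then show ?thesis using assms(2) by (intro GR_subst_le[of p x "\<lambda>_. u" _ y]) auto
qed

section \<open>Growth rate bounds along multiples of a fixed length\<close>

lemma growth_fun_mult_le:
  assumes "factorial_language L" "finite \<Sigma>"
  shows "growth_fun \<Sigma> L (n * Suc j) \<le> growth_fun \<Sigma> L n ^ Suc j"
proof (induction j)
  case (Suc j)
  have "growth_fun \<Sigma> L (n * Suc (Suc j)) \<le> growth_fun \<Sigma> L n * growth_fun \<Sigma> L (n * Suc j)"
    using growth_fun_add_le[OF assms, of n "n * Suc j"] by (simp add: algebra_simps)
  also have "\<dots> \<le> growth_fun \<Sigma> L n * growth_fun \<Sigma> L n ^ Suc j"
    using Suc by (rule mult_left_mono) simp
  finally show ?case by simp
qed simp

lemma LIMSEQ_multiples: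
  assumes "X \<longlonglongrightarrow> L" and "n > 0"
  shows "(\<lambda>j. X (n * Suc j)) \<longlonglongrightarrow> L"
  using LIMSEQ_subseq_LIMSEQ[OF assms(1), of "\<lambda>j. n * Suc j"] assms(2)
  by (simp add: strict_mono_def o_def del: mult_Suc_right)

text \<open>Submultiplicativity carries the bound at the single length \<open>n\<close> to all
  multiples of \<open>n\<close>, along which the limit can be taken.\<close>

lemma GR_le:
  assumes "n > 0" and "real (growth_fun {..<k} (avoiding_words {..<k} p) n) \<le> c ^ n" and "c \<ge> 0"
  shows "GR k p \<le> c"
proof (rule LIMSEQ_le_const2[OF LIMSEQ_multiples[OF GR_LIMSEQ \<open>n > 0\<close>]], intro exI[of _ 0] allI impI)
  fix j
  let ?f = "growth_fun {..<k} (avoiding_words {..<k} p)"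
  have "real (?f (n * Suc j)) \<le> real (?f n) ^ Suc j"
    using growth_fun_mult_le[OF factorial_avoiding_words finite_lessThan]
    by (metis of_nat_le_iff of_nat_power)
  also have "\<dots> \<le> (c ^ n) ^ Suc j" by (intro power_mono assms) simp
  also have "\<dots> = c ^ (n * Suc j)" by (simp only: power_mult)
  finally have "root (n * Suc j) (real (?f (n * Suc j))) \<le> root (n * Suc j) (c ^ (n * Suc j))"
    using \<open>n > 0\<close> by (subst real_root_le_iff) auto
  also have "\<dots> = c" using assms by (intro real_root_power_cancel) auto
  finally show "root (n * Suc j) (real (?f (n * Suc j))) \<le> c" .
qed

text \<open>The limit exists, so a subsequence determines it. Multiples of \<open>n\<close> suit a
  periodic construction, whose growth is regular over whole periods.\<close>

lemma GR_ge:
  assumes "n > 0" and "c \<ge> 0"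
    and "\<And>j. c ^ (n * j) \<le> real (growth_fun {..<k} (avoiding_words {..<k} p) (n * j))"
  shows "c \<le> GR k p"
proof (rule LIMSEQ_le_const[OF LIMSEQ_multiples[OF GR_LIMSEQ \<open>n > 0\<close>]], intro exI[of _ 0] allI impI)
  fix j
  let ?f = "growth_fun {..<k} (avoiding_words {..<k} p)"
  have "c = root (n * Suc j) (c ^ (n * Suc j))"
    using assms by (intro real_root_power_cancel[symmetric]) auto
  also have "\<dots> \<le> root (n * Suc j) (real (?f (n * Suc j)))"
    using assms(1) assms(3)[of "Suc j"] by (subst real_root_le_iff) auto
  finally show "c \<le> root (n * Suc j) (real (?f (n * Suc j)))" .
qed

subsection \<open>Square-free ternary words\<close>

text \<open>The word tested is \<open>u @ w\<close>. The accumulator \<open>u\<close> grows into the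
  candidate root of a square, one letter of \<open>w\<close> at a time.\<close>

fun has_square_prefix :: "'a list \<Rightarrow> 'a list \<Rightarrow> bool" where
  "has_square_prefix u [] = False"
| "has_square_prefix u (a # w) = (prefix (u @ [a]) w \<or> has_square_prefix (u @ [a]) w)"

lemma has_square_prefix_sound:
  "has_square_prefix u w \<Longrightarrow> \<exists>v. v \<noteq> [] \<and> prefix (v @ v) (u @ w)"
proof (induction u w rule: has_square_prefix.induct)
  case (2 u a w)
  show ?case
  proof (cases "prefix (u @ [a]) w")
    case True
    then obtain z where "w = (u @ [a]) @ z" by (auto simp: prefix_def)
    then have "u @ a # w = ((u @ [a]) @ (u @ [a])) @ z" by simp
    then show ?thesis by (metis append_is_Nil_conv not_Cons_self2 prefixI)
  next
    case False
    then have "has_square_prefix (u @ [a]) w" using "2.prems" by simp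
    from "2.IH"[OF this] show ?thesis by simp
  qed
qed simp

text \<open>A letter put in front of a square-free word can create squares at the front only, so
  testing prefixes suffices.\<close>

fun square_free_words :: "nat \<Rightarrow> nat list list" where
  "square_free_words 0 = [[]]"
| "square_free_words (Suc n) =
     filter (\<lambda>w. \<not> has_square_prefix [] w)
       (concat (map (\<lambda>w. [0 # w, Suc 0 # w, Suc (Suc 0) # w]) (square_free_words n)))"

text \<open>This inclusion turns the length of the computed list into an upper bound for the number
  of square-free words.\<close>

lemma square_free_words_complete:
  assumes "set w \<subseteq> {..<3}" and "\<not> (\<exists>u. u \<noteq> [] \<and> sublist (u @ u) w)"
  shows "w \<in> set (square_free_words (length w))"
  using assms
proof (induction w)
  case (Cons a w)
  have "\<not> (\<exists>u. u \<noteq> [] \<and> sublist (u @ u) w)"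
    using Cons.prems(2) by (meson sublist_Cons_right)
  then have "w \<in> set (square_free_words (length w))" using Cons by simp
  moreover have "\<not> has_square_prefix [] (a # w)"
  proof
    assume "has_square_prefix [] (a # w)"
    then obtain v where "v \<noteq> []" "prefix (v @ v) (a # w)"
      using has_square_prefix_sound[of "[]" "a # w"] by (auto simp del: has_square_prefix.simps)
    then show False using Cons.prems(2) prefix_imp_sublist by blast
  qed
  moreover have "a = 0 \<or> a = Suc 0 \<or> a = Suc (Suc 0)" using Cons.prems(1) by auto
  ultimately show ?case by (simp del: has_square_prefix.simps) blast
qed simp

lemma length_square_free_words: "length (square_free_words 13) = 342"
  by code_simp

lemma GR_AA_le: "GR 3 [A, A] \<le> 79/50"
proof (rule GR_le[where n = 13])
  have "avoiding_words {..<3} [A, A] \<inter> {w \<in> lists {..<3 :: nat}. length w = 13}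
      \<subseteq> set (square_free_words 13)"
  proof
    fix w :: "nat list" assume "w \<in> avoiding_words {..<3} [A, A] \<inter> {w \<in> lists {..<3}. length w = 13}"
    then have w: "w \<in> lists {..<3}" "length w = 13" "avoids {..<3} [A, A] w"
      by (simp_all add: avoiding_words_def)
    have "set w \<subseteq> {..<3}" using w(1) by (auto simp: in_lists_conv_set)
    moreover have "\<not> (\<exists>u. u \<noteq> [] \<and> sublist (u @ u) w)" 
      using w(3) avoids_AA_iff[OF w(1)] by (rule iffD1[rotated])
    ultimately have "w \<in> set (square_free_words (length w))" by (rule square_free_words_complete)
    then show "w \<in> set (square_free_words 13)" by (simp only: w(2))
  qed
  then have "growth_fun {..<3 :: nat} (avoiding_words {..<3} [A, A]) 13 \<le> card (set (square_free_words 13))"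
    unfolding growth_fun_def by (intro card_mono) auto
  also have "\<dots> \<le> 342" using card_length[of "square_free_words 13"] by (simp only: length_square_free_words)
  finally have "real (growth_fun {..<3 :: nat} (avoiding_words {..<3} [A, A]) 13) \<le> 342" by simp
  also have "(342 :: real) \<le> (79/50) ^ 13" by (simp add: power_divide)
  finally show "real (growth_fun {..<3 :: nat} (avoiding_words {..<3} [A, A]) 13) \<le> (79/50) ^ 13" .
qed simp_all

subsection \<open>Counting avoiding words\<close>

lemma occurs_mono: "occurs p u \<Longrightarrow> sublist u w \<Longrightarrow> occurs p w"
  unfolding occurs_def by (meson sublist_order.order_trans)

lemma not_occurs_Nil: assumes "p \<noteq> []" shows "\<not> occurs p []"
proof
  assume "occurs p []"
  then obtain f where "\<forall>X\<in>set p. f X \<noteq> []" "concat (map f p) = []"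
    by (auto simp: occurs_def)
  then show False using assms by (cases p) auto
qed

text \<open>Known block lengths fix where the word is cut, so the blocks can be read off.\<close>

lemma concat_map_inj:
  assumes "concat (map f u) = concat (map g u)" and "\<And>X. X \<in> set u \<Longrightarrow> length (f X) = length (g X)"
    and "X \<in> set u"
  shows "f X = g X"
  using assms
proof (induction u)
  case (Cons Y u)
  have "f Y = g Y \<and> concat (map f u) = concat (map g u)"
    using Cons.prems(1,2) by (simp add: append_eq_append_conv)
  then show ?case using Cons by auto
qed simp

abbreviation len :: "('v \<Rightarrow> nat) \<Rightarrow> 'v list \<Rightarrow> nat" where
  "len l u \<equiv> sum_list (map l u)"

lemma split_at_first:
  assumes "X \<in> set u"
  obtains c where "u = takeWhile (\<lambda>Y. Y \<noteq> X) u @ X # c"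
proof -
  have ne: "dropWhile (\<lambda>Y. Y \<noteq> X) u \<noteq> []" using assms by (simp add: dropWhile_eq_Nil_conv)
  then have "hd (dropWhile (\<lambda>Y. Y \<noteq> X) u) = X" using hd_dropWhile[OF ne] by simp
  then have "dropWhile (\<lambda>Y. Y \<noteq> X) u = X # tl (dropWhile (\<lambda>Y. Y \<noteq> X) u)"
    using ne by (metis list.collapse)
  then show ?thesis using that takeWhile_dropWhile_id by metis
qed

lemma length_concat_map: "length (concat (map f u)) = len (\<lambda>X. length (f X)) u"
  by (simp add: length_concat comp_def)

lemma len_cong: "(\<And>X. X \<in> set u \<Longrightarrow> l X = l' X) \<Longrightarrow> len l u = len l' u"
  by (simp cong: map_cong)

text \<open>The state advances independently of the letter read, so it prescribes an alphabet for
  each position and words are counted by a plain product. Unrestricted words use a constant state,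
  the periodic construction uses phases modulo 14.\<close>

locale automaton =
  fixes nx :: "'q \<Rightarrow> 'q" and C :: "'q \<Rightarrow> 'a set"
  assumes finite_C: "finite (C q)"
begin

primrec fits :: "'q \<Rightarrow> 'a list \<Rightarrow> bool" where
  "fits q [] = True"
| "fits q (a # w) = (a \<in> C q \<and> fits (nx q) w)"

lemma fits_append: "fits q (u @ v) \<longleftrightarrow> fits q u \<and> fits ((nx ^^ length u) q) v"
  by (induction u arbitrary: q) (auto simp: funpow_swap1)

definition words_from :: "'q \<Rightarrow> nat \<Rightarrow> 'a list set" where
  "words_from q n = {w. length w = n \<and> fits q w}"

definition num_words :: "'q \<Rightarrow> nat \<Rightarrow> nat" where
  "num_words q n = (\<Prod>i<n. card (C ((nx ^^ i) q)))"

lemma words_from_Suc: "words_from q (Suc n) = (\<lambda>(a, w). a # w) ` (C q \<times> words_from (nx q) n)"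
proof
  show "words_from q (Suc n) \<subseteq> (\<lambda>(a, w). a # w) ` (C q \<times> words_from (nx q) n)"
  proof
    fix w assume "w \<in> words_from q (Suc n)"
    then show "w \<in> (\<lambda>(a, w). a # w) ` (C q \<times> words_from (nx q) n)"
      by (cases w) (auto simp: words_from_def)
  qed
qed (auto simp: words_from_def)

lemma num_words_Suc: "num_words q (Suc n) = card (C q) * num_words (nx q) n"
  unfolding num_words_def
  by (simp only: prod.lessThan_Suc_shift funpow_simps_right(2) comp_def funpow_0 o_apply)

lemma card_words_from: "finite (words_from q n) \<and> card (words_from q n) = num_words q n"
proof (induction n arbitrary: q)
  case 0
  have "words_from q 0 = {[]}" by (auto simp: words_from_def)
  then show ?case by (simp add: num_words_def)
next
  case (Suc n)
  have "inj_on (\<lambda>(a, w). a # w) (C q \<times> words_from (nx q) n)" by (auto simp: inj_on_def)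
  then have "card (words_from q (Suc n)) = num_words q (Suc n)"
    unfolding words_from_Suc num_words_Suc using Suc by (simp add: card_image card_cartesian_product)
  then show ?case using Suc finite_C by (simp add: words_from_Suc)
qed

end

text \<open>In the word \<open>p1 @ p2\<close>, the part \<open>p1\<close> is the one that is deleted from an occurrence. The weight
  \<open>wt q\<close> is the factor by which the number of avoiding words grows in state \<open>q\<close>, and \<open>feasible\<close> is any
  necessary condition on the lengths of the images in an occurrence that starts in state \<open>q\<close>.\<close>

locale counting = automaton nx C for nx :: "'q \<Rightarrow> 'q" and C :: "'q \<Rightarrow> 'a set" +
  fixes p1 p2 :: "'v list" and wt :: "'q \<Rightarrow> real" and feasible :: "'q \<Rightarrow> ('v \<Rightarrow> nat) \<Rightarrow> bool"
  assumes p1: "p1 \<noteq> []" and wt_pos: "wt q > 0"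
begin

definition "p = p1 @ p2"

definition wprod :: "'q \<Rightarrow> nat \<Rightarrow> real" where
  "wprod q n = (\<Prod>i<n. wt ((nx ^^ i) q))"

definition offset :: "('v \<Rightarrow> nat) \<Rightarrow> 'v \<Rightarrow> nat" where
  "offset l X = len l (takeWhile (\<lambda>Y. Y \<noteq> X) p1)"

text \<open>Bounds the information lost by deleting the image of \<open>p1\<close>: a variable of
  \<open>p2\<close> keeps a copy in the remainder, any other one is charged once, at its first
  occurrence, whose position fixes the state.\<close>

definition free_words :: "'q \<Rightarrow> ('v \<Rightarrow> nat) \<Rightarrow> nat" where
  "free_words q l = (\<Prod>X \<in> set p1 - set p2. num_words ((nx ^^ offset l X) q) (l X))"

definition good :: "'q \<Rightarrow> nat \<Rightarrow> 'a list set" where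
  "good q n = {w. length w = n \<and> fits q w \<and> \<not> occurs p w}"

definition shapes :: "'q \<Rightarrow> nat \<Rightarrow> ('v \<Rightarrow> nat) set" where
  "shapes q n = {l \<in> PiE (set p) (\<lambda>_. {1..n}). feasible q l}"

text \<open>Since \<open>tl w\<close> avoids \<open>p\<close>, any occurrence in \<open>w\<close>
  starts at the first letter. Sorting by the length vector \<open>l\<close> makes all cutting
  positions known.\<close>

definition bad :: "'q \<Rightarrow> nat \<Rightarrow> ('v \<Rightarrow> nat) \<Rightarrow> 'a list set" where
  "bad q n l = {w. length w = n \<and> fits q w \<and> \<not> occurs p (tl w) \<and>
     (\<exists>f. (\<forall>X\<in>set p. length (f X) = l X) \<and> prefix (concat (map f p)) w)}"

lemma finite_good: "finite (good q n)"
  by (rule finite_subset[of _ "words_from q n"])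
    (use card_words_from in \<open>auto simp: good_def words_from_def\<close>)

lemma finite_bad: "finite (bad q n l)"
  by (rule finite_subset[of _ "words_from q n"])
    (use card_words_from in \<open>auto simp: bad_def words_from_def\<close>)

lemma finite_shapes: "finite (shapes q n)"
  unfolding shapes_def by (rule finite_subset[of _ "PiE (set p) (\<lambda>_. {1..n})"]) (auto intro: finite_PiE)

lemma bad_decompose:
  assumes "w \<in> bad q n l"
  obtains f z where "\<And>X. X \<in> set p \<Longrightarrow> length (f X) = l X"
    and "w = concat (map f p1) @ concat (map f p2) @ z"
    and "length (concat (map f p1)) = len l p1" and "length (concat (map f p2)) = len l p2"
    and "\<And>X. X \<in> set p1 - set p2 \<Longrightarrow> take (l X) (drop (offset l X) w) = f X"
    and "\<And>X. X \<in> set p1 - set p2 \<Longrightarrow> fits ((nx ^^ offset l X) q) (f X)"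
proof -
  obtain f where f: "\<forall>X\<in>set p. length (f X) = l X" and pre: "prefix (concat (map f p)) w"
    and fits: "fits q w" using assms unfolding bad_def by auto
  obtain z where z: "w = concat (map f p1) @ concat (map f p2) @ z"
    using pre by (auto simp: prefix_def p_def)
  have len: "length (concat (map f u)) = len l u" if "set u \<subseteq> set p" for u
    unfolding length_concat_map using f that by (intro len_cong) auto
  have *: "take (l X) (drop (offset l X) w) = f X \<and> fits ((nx ^^ offset l X) q) (f X)"
    if X: "X \<in> set p1 - set p2" for X
  proof -
    define a where "a = takeWhile (\<lambda>Y. Y \<noteq> X) p1"
    obtain c where p1_eq: "p1 = a @ X # c" using X split_at_first[of X p1] unfolding a_def by auto
    have lena: "length (concat (map f a)) = offset l X"
      unfolding offset_def a_def[symmetric] by (rule len) (auto simp: a_def p_def dest: set_takeWhileD)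
    have w: "w = concat (map f a) @ f X @ (concat (map f c) @ concat (map f p2) @ z)"
      unfolding z p1_eq by simp
    have "length (f X) = l X" using f X by (auto simp: p_def)
    then have "take (l X) (drop (offset l X) w) = f X" unfolding w lena[symmetric] by simp
    moreover have "fits ((nx ^^ offset l X) q) (f X)"
      using fits unfolding w fits_append lena by blast
    ultimately show ?thesis by blast
  qed
  show ?thesis
  proof (rule that)
    show "length (f X) = l X" if "X \<in> set p" for X using f that by blast
    show "length (concat (map f p1)) = len l p1" "length (concat (map f p2)) = len l p2"
      by (rule len, simp add: p_def)+
  qed (use z * in blast)+
qed

text \<open>A bad word is recovered from what is left after deleting the image of \<open>p1\<close>, since this
  begins with the image of \<open>p2\<close>, and from the images of the variables that do not occur in \<open>p2\<close>.\<close>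

lemma card_bad_le:
  assumes l: "\<And>X. X \<in> set p \<Longrightarrow> l X \<ge> 1"
  shows "card (bad q n l) \<le> card (good ((nx ^^ len l p1) q) (n - len l p1)) * free_words q l"
proof -
  let ?V = "set p1 - set p2" and ?r = "len l p1"
  let ?T = "good ((nx ^^ ?r) q) (n - ?r) \<times> (PiE ?V (\<lambda>X. words_from ((nx ^^ offset l X) q) (l X)))"
  let ?\<phi> = "\<lambda>w. (drop ?r w, restrict (\<lambda>X. take (l X) (drop (offset l X) w)) ?V)"
  have img: "?\<phi> ` bad q n l \<subseteq> ?T"
  proof (intro image_subsetI)
    fix w assume w: "w \<in> bad q n l"
    obtain f z where f: "\<And>X. X \<in> set p \<Longrightarrow> length (f X) = l X"
      and z: "w = concat (map f p1) @ concat (map f p2) @ z"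
      and r: "length (concat (map f p1)) = ?r"
      and V: "\<And>X. X \<in> ?V \<Longrightarrow> take (l X) (drop (offset l X) w) = f X"
        "\<And>X. X \<in> ?V \<Longrightarrow> fits ((nx ^^ offset l X) q) (f X)"
      using bad_decompose[OF w] by metis
    have w': "length w = n" "fits q w" "\<not> occurs p (tl w)" using w by (auto simp: bad_def)
    have d: "drop ?r w = concat (map f p2) @ z" unfolding z r[symmetric] by simp
    have "l (hd p1) \<ge> 1" using l p1 by (simp add: p_def)
    then have "?r \<ge> 1" using p1 by (cases p1) auto
    \<comment> \<open>At least one letter is deleted, so the remainder is a suffix of
      \<open>tl w\<close> and inherits avoidance from it.\<close>
    then have "drop ?r w = drop (?r - 1) (tl w)" by (simp add: drop_Suc[symmetric])
    then have "\<not> occurs p (drop ?r w)" using w'(3) occurs_mono[OF _ sublist_drop] by metis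
    moreover have "fits ((nx ^^ ?r) q) (drop ?r w)"
      using w'(2) unfolding d unfolding z fits_append[of q "concat (map f p1)"] r by blast
    ultimately have "drop ?r w \<in> good ((nx ^^ ?r) q) (n - ?r)" by (simp add: good_def w'(1))
    moreover have "restrict (\<lambda>X. take (l X) (drop (offset l X) w)) ?V
        \<in> PiE ?V (\<lambda>X. words_from ((nx ^^ offset l X) q) (l X))"
      using V f by (auto simp: words_from_def p_def)
    ultimately show "?\<phi> w \<in> ?T" by simp
  qed
  have inj: "inj_on ?\<phi> (bad q n l)"
  proof (rule inj_onI)
    fix w w' assume w: "w \<in> bad q n l" and w': "w' \<in> bad q n l" and eq: "?\<phi> w = ?\<phi> w'"
    obtain f z where f: "\<And>X. X \<in> set p \<Longrightarrow> length (f X) = l X"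
      and z: "w = concat (map f p1) @ concat (map f p2) @ z"
      and r: "length (concat (map f p1)) = ?r" "length (concat (map f p2)) = len l p2"
      and V: "\<And>X. X \<in> ?V \<Longrightarrow> take (l X) (drop (offset l X) w) = f X"
      using bad_decompose[OF w] by metis
    obtain f' z' where f': "\<And>X. X \<in> set p \<Longrightarrow> length (f' X) = l X"
      and z': "w' = concat (map f' p1) @ concat (map f' p2) @ z'"
      and r': "length (concat (map f' p1)) = ?r" "length (concat (map f' p2)) = len l p2"
      and V': "\<And>X. X \<in> ?V \<Longrightarrow> take (l X) (drop (offset l X) w') = f' X"
      using bad_decompose[OF w'] by metis
    have d: "concat (map f p2) @ z = concat (map f' p2) @ z'"
    proof -
      have "drop ?r w = concat (map f p2) @ z" unfolding z r(1)[symmetric] by simp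
      moreover have "drop ?r w' = concat (map f' p2) @ z'" unfolding z' r'(1)[symmetric] by simp
      ultimately show ?thesis using eq by simp
    qed
    then have d2: "concat (map f p2) = concat (map f' p2)"
      using append_eq_append_conv[of "concat (map f p2)" "concat (map f' p2)" z z'] r(2) r'(2) by metis
    have "f X = f' X" if "X \<in> set p1" for X
    proof (cases "X \<in> set p2")
      case True
      then show ?thesis using concat_map_inj[OF d2 _ True] f f' by (simp add: p_def)
    next
      case False
      then have X: "X \<in> ?V" using that by simp
      have "snd (?\<phi> w) X = snd (?\<phi> w') X" by (simp only: eq)
      then show ?thesis using V[OF X] V'[OF X] X by simp
    qed
    then have "map f p1 = map f' p1" by simp
    then show "w = w'" unfolding z z' d by (simp only:)
  qed
  have "finite ?T"
    using card_words_from finite_good by (intro finite_cartesian_product finite_PiE) auto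
  then have "card (bad q n l) \<le> card ?T" by (rule card_inj_on_le[OF inj img])
  also have "\<dots> = card (good ((nx ^^ ?r) q) (n - ?r)) * free_words q l"
    using card_words_from by (simp add: card_cartesian_product card_PiE free_words_def)
  finally show ?thesis .
qed

lemma wprod_Suc: "wprod q (Suc n) = wt q * wprod (nx q) n"
  unfolding wprod_def by (simp only: prod.lessThan_Suc_shift funpow_simps_right(2) comp_def) simp

lemma wprod_pos: "wprod q n > 0"
  unfolding wprod_def by (intro prod_pos) (simp add: wt_pos)

text \<open>Iterates the one-step growth bound \<open>j\<close> times. The bound is assumed for
  lengths below \<open>n\<close> only, so that this can be applied inside the induction that proves
  it.\<close>

lemma wprod_chain:
  assumes "\<And>m q. m < n \<Longrightarrow> wt q * card (good (nx q) m) \<le> card (good q (Suc m))" and "j \<le> n"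
  shows "wprod q j * card (good ((nx ^^ j) q) (n - j)) \<le> card (good q n)"
  using assms
proof (induction j arbitrary: q n)
  case 0
  then show ?case by (simp add: wprod_def)
next
  case (Suc j)
  then obtain m where m: "n = Suc m" "j \<le> m" by (cases n) auto
  have "wprod (nx q) j * card (good ((nx ^^ j) (nx q)) (m - j)) \<le> card (good (nx q) m)"
    using Suc m by (intro Suc.IH) auto
  then have "wt q * (wprod (nx q) j * card (good ((nx ^^ j) (nx q)) (m - j)))
      \<le> wt q * card (good (nx q) m)"
    using wt_pos[of q] by (intro mult_left_mono) auto
  also have "\<dots> \<le> card (good q n)" using Suc.prems m by simp
  finally show ?case by (simp add: wprod_Suc m funpow_swap1 mult.assoc)
qed

context
  assumes feasible: "\<And>q w f. fits q w \<Longrightarrow> \<forall>X\<in>set p. f X \<noteq> [] \<Longrightarrow> prefix (concat (map f p)) w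
    \<Longrightarrow> feasible q (restrict (\<lambda>X. length (f X)) (set p))"
  and weights: "\<And>q n. (\<Sum>l\<in>shapes q n. free_words q l / wprod q (len l p1)) \<le> card (C q) / wt q - 1"
begin

text \<open>Prepending a letter gives \<open>card (C q) * card (good (nx q) n)\<close> words, each
  of which is good or bad for some shape. By induction, the bad words of shape \<open>l\<close>
  number at most \<open>wt q * card (good (nx q) n)\<close> times the summand in
  \<open>weights\<close>; that hypothesis is exactly what leaves a factor \<open>wt q\<close> after
  subtraction.\<close>

lemma good_Suc_ge: "wt q * card (good (nx q) n) \<le> card (good q (Suc n))"
proof (induction n arbitrary: q rule: less_induct)
  case (less n)
  let ?g = "real (card (good (nx q) n))"
  define W where "W = (\<lambda>(a, w). a # w) ` (C q \<times> good (nx q) n)"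
  have "card W = card (C q) * card (good (nx q) n)"
    unfolding W_def by (subst card_image) (auto simp: inj_on_def card_cartesian_product)
  have finW: "finite W" unfolding W_def using finite_C finite_good by auto
  have sub: "W \<subseteq> good q (Suc n) \<union> (\<Union>l\<in>shapes q (Suc n). bad q (Suc n) l)"
  proof
    fix u assume "u \<in> W"
    then obtain a w where u: "u = a # w" "a \<in> C q" "w \<in> good (nx q) n" by (auto simp: W_def)
    then have fu: "length u = Suc n" "fits q u" "\<not> occurs p w" by (auto simp: good_def)
    show "u \<in> good q (Suc n) \<union> (\<Union>l\<in>shapes q (Suc n). bad q (Suc n) l)"
    proof (cases "occurs p u")
      case False
      then show ?thesis using fu by (simp add: good_def)
    next
      case True
      then obtain f where f: "\<forall>X\<in>set p. f X \<noteq> []" "sublist (concat (map f p)) u"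
        unfolding occurs_def by auto
      have "\<not> sublist (concat (map f p)) w" using f(1) fu(3) unfolding occurs_def by auto
      then have pre: "prefix (concat (map f p)) u" using f(2) u(1) by (simp add: sublist_Cons_right)
      define l where "l = restrict (\<lambda>X. length (f X)) (set p)"
      have "length (f X) \<in> {1..Suc n}" if "X \<in> set p" for X
      proof -
        have "length (f X) \<le> length (concat (map f p))"
          unfolding length_concat_map using that by (intro member_le_sum_list) auto
        also have "\<dots> \<le> Suc n" using prefix_length_le[OF pre] fu(1) by simp
        finally show ?thesis using f(1) that by (simp add: Suc_le_eq)
      qed
      then have "l \<in> PiE (set p) (\<lambda>_. {1..Suc n})" by (simp add: l_def)
      moreover have "feasible q l" unfolding l_def by (rule feasible[OF fu(2) f(1) pre])
      ultimately have "l \<in> shapes q (Suc n)" by (simp add: shapes_def)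
      moreover have "u \<in> bad q (Suc n) l"
        unfolding bad_def using fu pre u(1) by (auto simp: l_def)
      ultimately show ?thesis by blast
    qed
  qed
  have "real (card (C q)) * ?g = card W" by (simp add: \<open>card W = _\<close>)
  also have "card W \<le> card (good q (Suc n) \<union> (\<Union>l\<in>shapes q (Suc n). bad q (Suc n) l))"
    using sub finite_good finite_shapes finite_bad by (intro card_mono) auto
  also have "\<dots> \<le> card (good q (Suc n)) + card (\<Union>l\<in>shapes q (Suc n). bad q (Suc n) l)"
    by (rule card_Un_le)
  also have "\<dots> \<le> card (good q (Suc n)) + (\<Sum>l\<in>shapes q (Suc n). card (bad q (Suc n) l))"
    using card_UN_le[OF finite_shapes] by simp
  finally have 1: "card (C q) * ?g \<le> card (good q (Suc n))
      + (\<Sum>l\<in>shapes q (Suc n). real (card (bad q (Suc n) l)))" by (simp flip: of_nat_sum)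
  have "real (card (bad q (Suc n) l)) \<le> ?g * wt q * (free_words q l / wprod q (len l p1))"
    if l: "l \<in> shapes q (Suc n)" for l
  proof (cases "len l p1 \<le> Suc n")
    case False
    \<comment> \<open>Truncated subtraction would break the chain estimate here, but no bad word is
      shorter than the image of \<open>p1\<close>.\<close>
    have "bad q (Suc n) l = {}"
    proof (rule ccontr)
      assume "bad q (Suc n) l \<noteq> {}"
      then obtain w where w: "w \<in> bad q (Suc n) l" by blast
      obtain f z where "w = concat (map f p1) @ concat (map f p2) @ z"
        "length (concat (map f p1)) = len l p1" using bad_decompose[OF w] by metis
      then have "len l p1 \<le> length w" by (metis le_add1 length_append)
      then show False using w False by (simp add: bad_def)
    qed
    then show ?thesis using wprod_pos[of q "len l p1"] wt_pos[of q] by simp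
  next
    case True
    have l1: "l X \<ge> 1" if "X \<in> set p" for X using l that by (auto simp: shapes_def PiE_iff)
    have "l (hd p1) \<ge> 1" using l1 p1 by (simp add: p_def)
    then have "len l p1 \<ge> 1" using p1 by (cases p1) auto
    then obtain r where r: "len l p1 = Suc r" by (cases "len l p1") auto
    \<comment> \<open>Deleting \<open>Suc r\<close> of \<open>Suc n\<close> letters leaves
      \<open>n - r\<close>. The induction hypothesis, chained over \<open>r\<close> steps starting
      in \<open>nx q\<close>, compares this length with \<open>n\<close>.\<close>
    have "wprod (nx q) r * card (good ((nx ^^ r) (nx q)) (n - r)) \<le> ?g"
      using True r less by (intro wprod_chain) auto
    then have "wprod q (Suc r) * card (good ((nx ^^ Suc r) q) (Suc n - Suc r)) \<le> ?g * wt q"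
      using wt_pos[of q] by (simp add: wprod_Suc funpow_swap1 mult.commute)
    then have *: "real (card (good ((nx ^^ Suc r) q) (Suc n - Suc r))) \<le> ?g * wt q / wprod q (Suc r)"
      using wprod_pos[of q "Suc r"] by (simp add: pos_le_divide_eq mult.commute)
    have "real (card (bad q (Suc n) l))
        \<le> real (card (good ((nx ^^ Suc r) q) (Suc n - Suc r))) * real (free_words q l)"
      using card_bad_le[of l q "Suc n"] l1 unfolding r by (simp flip: of_nat_mult del: diff_Suc_Suc)
    also have "\<dots> \<le> ?g * wt q / wprod q (Suc r) * real (free_words q l)"
      by (intro mult_right_mono *) simp
    finally show ?thesis by (simp add: r)
  qed
  then have "(\<Sum>l\<in>shapes q (Suc n). real (card (bad q (Suc n) l)))
      \<le> (\<Sum>l\<in>shapes q (Suc n). ?g * wt q * (free_words q l / wprod q (len l p1)))"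
    by (rule sum_mono)
  also have "\<dots> = ?g * wt q * (\<Sum>l\<in>shapes q (Suc n). free_words q l / wprod q (len l p1))"
    by (simp only: sum_distrib_left)
  also have "\<dots> \<le> ?g * wt q * (card (C q) / wt q - 1)"
    using wt_pos[of q] by (intro mult_left_mono weights) simp
  also have "\<dots> = card (C q) * ?g - wt q * ?g"
    using wt_pos[of q] by (simp add: field_simps)
  finally show ?case using 1 by linarith
qed

theorem card_good_ge: "wprod q n \<le> card (good q n)"
proof -
  have "good q' 0 = {[]}" for q'
    using not_occurs_Nil[of p] p1 by (auto simp: good_def p_def)
  then show ?thesis using wprod_chain[OF good_Suc_ge, of n n q] by simp
qed

end

end

subsection \<open>Unrestricted ternary words\<close>

lemma (in counting) good_subset_avoiding:
  assumes "\<And>q. C q \<subseteq> \<Sigma>"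
  shows "good q n \<subseteq> avoiding_words \<Sigma> p \<inter> {w \<in> lists \<Sigma>. length w = n}"
proof -
  have "w \<in> lists \<Sigma>" if "fits q w" for w
    using that assms by (induction w arbitrary: q) auto
  moreover have "p \<noteq> []" using p1 by (simp add: p_def)
  ultimately show ?thesis by (auto simp: good_def avoiding_words_eq)
qed

lemma sum_powers_le:
  fixes w :: real
  assumes "0 \<le> w" "w < 1"
  shows "(\<Sum>i=1..n. w ^ i) \<le> w / (1 - w)"
proof -
  have "(1 - w) * (\<Sum>i=1..n. w ^ i) = w - w ^ Suc n"
  proof (induction n)
    case (Suc n)
    have "(1 - w) * (\<Sum>i=1..Suc n. w ^ i) = (1 - w) * (\<Sum>i=1..n. w ^ i) + (1 - w) * w ^ Suc n"
      by (simp add: distrib_left)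
    also have "\<dots> = w - w ^ Suc n + (1 - w) * w ^ Suc n" by (simp only: Suc)
    also have "\<dots> = w - w ^ Suc (Suc n)" by (simp add: algebra_simps)
    finally show ?case .
  qed simp
  then show ?thesis using assms by (simp add: pos_le_divide_eq mult.commute)
qed

lemma len_eq_sum:
  assumes "finite V" "set u \<subseteq> V"
  shows "len l u = (\<Sum>X\<in>V. count_list u X * l X)"
  unfolding sum_list_map_eq_sum_count
  using assms by (intro sum.mono_neutral_left) (auto simp: count_list_0_iff)

text \<open>With constant weight \<open>\<beta>\<close> the sum over length vectors factorises into
  one geometric series per variable. Its ratio is 1 or 3, depending on whether the image survives in
  \<open>p2\<close>, divided by \<open>\<beta>\<close> once per deleted copy; \<open>v\<close>
  bounds the ratio.\<close>

lemma GR_ge_unrestricted: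
  fixes p1 p2 :: "'v list" and \<beta> :: real and v :: "'v \<Rightarrow> real"
  assumes p1: "p1 \<noteq> []" and \<beta>: "\<beta> > 0"
    and v: "\<And>X. X \<in> set (p1 @ p2) \<Longrightarrow>
      (if X \<in> set p1 - set p2 then 3 else 1) / \<beta> ^ count_list p1 X \<le> v X \<and> v X < 1"
    and prod: "(\<Prod>X\<in>set (p1 @ p2). v X / (1 - v X)) \<le> 3 / \<beta> - 1"
  shows "\<beta> \<le> GR 3 (p1 @ p2)"
proof -
  interpret counting "\<lambda>q :: bool. q" "\<lambda>_. {..<3 :: nat}" p1 p2 "\<lambda>_. \<beta>" "\<lambda>_ _. True"
    by unfold_locales (use p1 \<beta> in auto)
  have p: "p = p1 @ p2" by (rule p_def)
  define c where "c X = (if X \<in> set p1 - set p2 then 3 else 1 :: real)" for X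
  have wprod: "wprod q n = \<beta> ^ n" for q n by (simp add: wprod_def)
  have free: "real (free_words q l) = (\<Prod>X\<in>set p. c X ^ l X)" for q l
  proof -
    have "real (free_words q l) = (\<Prod>X\<in>set p1 - set p2. 3 ^ l X)"
      by (simp add: free_words_def num_words_def)
    also have "\<dots> = (\<Prod>X\<in>set p1 - set p2. c X ^ l X)"
      by (rule prod.cong) (auto simp: c_def)
    also have "\<dots> = (\<Prod>X\<in>set p. c X ^ l X)"
      by (rule prod.mono_neutral_left) (auto simp: c_def p)
    finally show ?thesis .
  qed
  have shape: "free_words q l / wprod q (len l p1) = (\<Prod>X\<in>set p. (c X / \<beta> ^ count_list p1 X) ^ l X)" for q l
  proof -
    have "\<beta> ^ len l p1 = (\<Prod>X\<in>set p. (\<beta> ^ count_list p1 X) ^ l X)"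
      unfolding len_eq_sum[of "set p" p1 l, simplified p, simplified] p
      by (simp add: power_sum power_mult)
    then show ?thesis by (simp add: wprod free prod_dividef power_divide)
  qed
  have cv: "0 \<le> c X / \<beta> ^ count_list p1 X" "c X / \<beta> ^ count_list p1 X \<le> v X" "v X < 1"
    if "X \<in> set p" for X
    using v[of X] that \<beta> by (auto simp: c_def p)
  have "wprod True n \<le> card (good True n)" for n
  proof (rule card_good_ge)
    fix q n
    have "(\<Sum>l\<in>shapes q n. free_words q l / wprod q (len l p1))
        = (\<Sum>l\<in>PiE (set p) (\<lambda>_. {1..n}). \<Prod>X\<in>set p. (c X / \<beta> ^ count_list p1 X) ^ l X)"
      unfolding shapes_def shape by simp
    also have "\<dots> = (\<Prod>X\<in>set p. \<Sum>i=1..n. (c X / \<beta> ^ count_list p1 X) ^ i)"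
      by (subst prod_sum_PiE) auto
    also have "\<dots> \<le> (\<Prod>X\<in>set p. v X / (1 - v X))"
    proof (rule prod_mono, intro conjI)
      fix X assume X: "X \<in> set p"
      have "(\<Sum>i=1..n. (c X / \<beta> ^ count_list p1 X) ^ i) \<le> (\<Sum>i=1..n. v X ^ i)"
        using cv[OF X] by (intro sum_mono power_mono)
      also have "\<dots> \<le> v X / (1 - v X)" using cv[OF X] by (intro sum_powers_le) auto
      finally show "(\<Sum>i=1..n. (c X / \<beta> ^ count_list p1 X) ^ i) \<le> v X / (1 - v X)" .
      show "0 \<le> (\<Sum>i=1..n. (c X / \<beta> ^ count_list p1 X) ^ i)"
        using cv[OF X] by (intro sum_nonneg zero_le_power)
    qed
    also have "\<dots> \<le> 3 / \<beta> - 1" using prod by (simp add: p)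
    finally show "(\<Sum>l\<in>shapes q n. free_words q l / wprod q (len l p1)) \<le> card {..<3 :: nat} / \<beta> - 1"
      by simp
  qed simp
  moreover have "card (good True n) \<le> growth_fun {..<3 :: nat} (avoiding_words {..<3} p) n" for n
    unfolding growth_fun_def
    by (rule card_mono[OF finite_lists_of_length good_subset_avoiding]) auto
  ultimately have "\<beta> ^ n \<le> real (growth_fun {..<3 :: nat} (avoiding_words {..<3} p) n)" for n
    unfolding wprod by (meson of_nat_le_iff order_trans)
  then show ?thesis using GR_ge[of 1 \<beta> 3 p] \<beta> by (simp add: p)
qed

text \<open>The whole pattern is deleted: each image is stored once while at least two copies
  disappear, giving ratios of at most \<open>3 / \<beta>\<^sup>2\<close>, or
  \<open>3 / \<beta> ^ 3\<close> for a variable with three occurrences.\<close>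

lemma GR_ge_doubled:
  fixes p :: "'v list"
  assumes p: "p \<noteq> []" and d: "doubled p"
    and k: "6 \<le> card (set p) \<or> 3 \<le> card (set p) \<and> (\<exists>X. 3 \<le> count_list p X)"
  shows "14/5 \<le> GR 3 p"
proof -
  let ?g = "\<lambda>v :: real. v / (1 - v)"
  have dbl: "count_list p X \<ge> 2" if "X \<in> set p" for X using d that by (simp add: doubled_def)
  have le: "3 / (14/5) ^ n \<le> (3 / (14/5) ^ m :: real)" if "m \<le> n" for m n :: nat
    using that by (intro divide_left_mono power_increasing) auto
  have g2: "?g (3 / (14/5)\<^sup>2) = 75/121" by (simp add: power2_eq_square)
  have "\<exists>v. (\<forall>X\<in>set p. 3 / (14/5) ^ count_list p X \<le> v X \<and> v X < 1)
      \<and> (\<Prod>X\<in>set p. ?g (v X)) \<le> 3 / (14/5) - 1"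
  proof (cases "6 \<le> card (set p)")
    case True
    have "(75/121 :: real) ^ card (set p) \<le> (75/121) ^ 6" using True by (intro power_decreasing) auto
    also have "\<dots> \<le> 3 / (14/5) - 1" by (simp add: power_divide)
    finally show ?thesis
      using dbl le[of 2] by (intro exI[of _ "\<lambda>_. 3 / (14/5)\<^sup>2"]) (simp add: g2 power2_eq_square)
  next
    case False
    then obtain X where k3: "3 \<le> card (set p)" and X: "3 \<le> count_list p X" using k by blast
    have Xp: "X \<in> set p" using X by (metis count_list_0_iff not_numeral_le_zero)
    define v :: "'v \<Rightarrow> real" where "v Y = (if Y = X then 3 / (14/5) ^ 3 else 3 / (14/5)\<^sup>2)" for Y
    have "(\<Prod>Y\<in>set p. ?g (v Y)) = ?g (v X) * (\<Prod>Y\<in>set p - {X}. ?g (v Y))"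
      by (rule prod.remove) (use Xp in auto)
    also have "(\<Prod>Y\<in>set p - {X}. ?g (v Y)) = (75/121) ^ (card (set p) - 1)"
      using Xp by (simp add: v_def power2_eq_square)
    also have "?g (v X) = 375/2369" by (simp add: v_def power3_eq_cube)
    also have "375/2369 * (75/121 :: real) ^ (card (set p) - 1) \<le> 375/2369 * (75/121)\<^sup>2"
      using k3 by (intro mult_left_mono power_decreasing) auto
    also have "\<dots> \<le> 3 / (14/5) - 1" by (simp add: power2_eq_square)
    finally have "(\<Prod>Y\<in>set p. ?g (v Y)) \<le> 3 / (14/5) - 1" .
    moreover have "3 / (14/5) ^ count_list p Y \<le> v Y \<and> v Y < 1" if "Y \<in> set p" for Y
      using le[OF X] le[OF dbl[OF that]] by (simp add: v_def power2_eq_square power3_eq_cube)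
    ultimately show ?thesis by blast
  qed
  then obtain v where "\<forall>X\<in>set p. 3 / (14/5) ^ count_list p X \<le> v X \<and> v X < 1"
    "(\<Prod>X\<in>set p. ?g (v X)) \<le> 3 / (14/5) - 1" by blast
  then show ?thesis using GR_ge_unrestricted[of p "14/5" "[]" v] p by simp
qed

text \<open>A variable of \<open>p2\<close> has one copy deleted and one kept, so its ratio is
  \<open>1 / \<beta>\<close>; any other has both copies deleted and one image stored, so its ratio
  is \<open>3 / \<beta>\<^sup>2\<close>. The bases in the last assumption are the sums of these
  geometric series.\<close>

lemma GR_ge_distinct_suffix:
  fixes p1 p2 :: "'v list"
  assumes two: "\<And>X. X \<in> set (p1 @ p2) \<Longrightarrow> count_list (p1 @ p2) X = 2" and dist: "distinct p2"
    and \<beta>: "\<beta> > 0" "3 / \<beta>\<^sup>2 < 1" and p2: "p2 \<noteq> []"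
    and le: "(1 / (\<beta> - 1)) ^ length p2 * (3 / (\<beta>\<^sup>2 - 3)) ^ (card (set (p1 @ p2)) - length p2) \<le> 3 / \<beta> - 1"
  shows "\<beta> \<le> GR 3 (p1 @ p2)"
proof (rule GR_ge_unrestricted[where v = "\<lambda>X. if X \<in> set p2 then 1 / \<beta> else 3 / \<beta>\<^sup>2"])
  let ?v = "\<lambda>X. if X \<in> set p2 then 1 / \<beta> else 3 / \<beta>\<^sup>2"
  have c2: "count_list p2 X = (if X \<in> set p2 then 1 else 0)" for X
    using dist by (induction p2) auto
  then have c1: "count_list p1 X = (if X \<in> set p2 then 1 else 2)" if "X \<in> set (p1 @ p2)" for X
    using two[OF that] by (simp split: if_splits)
  show "p1 \<noteq> []"
  proof
    assume "p1 = []"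
    then show False using c1[of "hd p2"] p2 by simp
  qed
  show "\<beta> > 0" by fact
  have "3 < \<beta>\<^sup>2" using \<beta> by (simp add: divide_less_eq split: if_splits)
  then have "1 < \<beta>" using \<beta>(1) by (smt (verit) one_power2 power2_le_imp_le power_mono)
  show "(if X \<in> set p1 - set p2 then 3 else 1) / \<beta> ^ count_list p1 X \<le> ?v X \<and> ?v X < 1"
    if "X \<in> set (p1 @ p2)" for X
    using c1[OF that] \<beta> \<open>1 < \<beta>\<close> that by (auto split: if_splits)
  have eq: "?v X / (1 - ?v X) = (if X \<in> set p2 then 1 / (\<beta> - 1) else 3 / (\<beta>\<^sup>2 - 3))" for X
  proof -
    have "1 - 1 / \<beta> = (\<beta> - 1) / \<beta>" "1 - 3 / \<beta>\<^sup>2 = (\<beta>\<^sup>2 - 3) / \<beta>\<^sup>2"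
      using \<beta>(1) by (simp_all add: diff_divide_distrib)
    then show ?thesis using \<beta>(1) by simp
  qed
  let ?h = "\<lambda>X. if X \<in> set p2 then 1 / (\<beta> - 1) else 3 / (\<beta>\<^sup>2 - 3)"
  have "(\<Prod>X\<in>set (p1 @ p2). ?v X / (1 - ?v X)) = (\<Prod>X\<in>set p2 \<union> (set (p1 @ p2) - set p2). ?h X)"
    unfolding eq by (rule prod.cong) auto
  also have "\<dots> = (\<Prod>X\<in>set p2. ?h X) * (\<Prod>X\<in>set (p1 @ p2) - set p2. ?h X)"
    by (rule prod.union_disjoint) auto
  also have "(\<Prod>X\<in>set p2. ?h X) = (1 / (\<beta> - 1)) ^ card (set p2)" by simp
  also have "(\<Prod>X\<in>set (p1 @ p2) - set p2. ?h X) = (3 / (\<beta>\<^sup>2 - 3)) ^ card (set (p1 @ p2) - set p2)"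
    by simp
  also have "card (set (p1 @ p2) - set p2) = card (set (p1 @ p2)) - length p2"
    using dist by (subst card_Diff_subset) (auto simp: distinct_card)
  also have "card (set p2) = length p2" by (rule distinct_card[OF dist])
  finally show "(\<Prod>X\<in>set (p1 @ p2). ?v X / (1 - ?v X)) \<le> 3 / \<beta> - 1" using le by simp
qed

subsection \<open>Periodically restricted ternary words\<close>

text \<open>The periodic word 00111111101111 of free positions was found by a computer search.\<close>

datatype phase = P0 | P1 | P2 | P3 | P4 | P5 | P6 | P7 | P8 | P9 | P10 | P11 | P12 | P13

primrec nxt :: "phase \<Rightarrow> phase" where
  "nxt P0 = P1" | "nxt P1 = P2" | "nxt P2 = P3" | "nxt P3 = P4" | "nxt P4 = P5" | "nxt P5 = P6"
| "nxt P6 = P7" | "nxt P7 = P8" | "nxt P8 = P9" | "nxt P9 = P10" | "nxt P10 = P11" | "nxt P11 = P12"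
| "nxt P12 = P13" | "nxt P13 = P0"

primrec is_free :: "phase \<Rightarrow> bool" where
  "is_free P0 = False" | "is_free P1 = False" | "is_free P2 = True" | "is_free P3 = True" | "is_free P4 = True"
| "is_free P5 = True" | "is_free P6 = True" | "is_free P7 = True" | "is_free P8 = True" | "is_free P9 = False"
| "is_free P10 = True" | "is_free P11 = True" | "is_free P12 = True" | "is_free P13 = True"

primrec succs :: "phase \<Rightarrow> phase list" where
  "succs P0 = [P1, P2, P3, P4, P5, P6, P7, P8, P9, P10, P11, P12, P13, P0]"
| "succs P1 = [P2, P3, P4, P5, P6, P7, P8, P9, P10, P11, P12, P13, P0, P1]"
| "succs P2 = [P3, P4, P5, P6, P7, P8, P9, P10, P11, P12, P13, P0, P1, P2]"
| "succs P3 = [P4, P5, P6, P7, P8, P9, P10, P11, P12, P13, P0, P1, P2, P3]"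
| "succs P4 = [P5, P6, P7, P8, P9, P10, P11, P12, P13, P0, P1, P2, P3, P4]"
| "succs P5 = [P6, P7, P8, P9, P10, P11, P12, P13, P0, P1, P2, P3, P4, P5]"
| "succs P6 = [P7, P8, P9, P10, P11, P12, P13, P0, P1, P2, P3, P4, P5, P6]"
| "succs P7 = [P8, P9, P10, P11, P12, P13, P0, P1, P2, P3, P4, P5, P6, P7]"
| "succs P8 = [P9, P10, P11, P12, P13, P0, P1, P2, P3, P4, P5, P6, P7, P8]"
| "succs P9 = [P10, P11, P12, P13, P0, P1, P2, P3, P4, P5, P6, P7, P8, P9]"
| "succs P10 = [P11, P12, P13, P0, P1, P2, P3, P4, P5, P6, P7, P8, P9, P10]"
| "succs P11 = [P12, P13, P0, P1, P2, P3, P4, P5, P6, P7, P8, P9, P10, P11]"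
| "succs P12 = [P13, P0, P1, P2, P3, P4, P5, P6, P7, P8, P9, P10, P11, P12]"
| "succs P13 = [P0, P1, P2, P3, P4, P5, P6, P7, P8, P9, P10, P11, P12, P13]"

primrec index :: "phase \<Rightarrow> nat" where
  "index P0 = 0" | "index P1 = 1" | "index P2 = 2" | "index P3 = 3" | "index P4 = 4"
| "index P5 = 5" | "index P6 = 6" | "index P7 = 7" | "index P8 = 8" | "index P9 = 9"
| "index P10 = 10" | "index P11 = 11" | "index P12 = 12" | "index P13 = 13" 

text \<open>Compares the free positions of the segment from \<open>s\<close> to \<open>e\<close>
  with those of the equally long segment starting at \<open>q\<close>, and returns the phase after
  the latter. Starting with \<open>s = e\<close> means a full turn. The termination measure counts
  the comparisons left after the current one.\<close>

function walk :: "phase \<Rightarrow> phase \<Rightarrow> phase \<Rightarrow> phase option" where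
  "walk s e q = (if is_free s = is_free q then (if nxt s = e then Some (nxt q) else walk (nxt s) e (nxt q)) else None)"
  by pat_completeness auto
termination
proof (relation "Wellfounded.measure (\<lambda>(s, e, q). (index e + 13 - index s) mod 14)")
  fix s e q :: phase
  assume "nxt s \<noteq> e"
  then show "((nxt s, e, nxt q), s, e, q) \<in> Wellfounded.measure (\<lambda>(s, e, q). (index e + 13 - index s) mod 14)"
    by (cases s; cases e) simp_all
qed simp

text \<open>The entries at index \<open>n - 1\<close> of \<open>tab1\<close> and \<open>tab2\<close> are \<open>1000 * 1.09 ^ n\<close> and \<open>1000 * 1.09 ^ (2 * n)\<close>,
  rounded up.\<close>

definition "tab1 = [1090, 1189, 1296, 1412, 1539, 1678, 1829, 1993, 2172, 2368, 2581, 2813, 3066, 3342 :: int]"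
definition "tab2 = [1189, 1412, 1678, 1993, 2368, 2813, 3342, 3971, 4718, 5605, 6659, 7912, 9400, 11168 :: int]"

text \<open>The list \<open>K\<close> holds the variables of \<open>p2\<close>: these are deleted
  once, the others twice, which doubles the exponent of 1.09.\<close>

abbreviation tab :: "nat list \<Rightarrow> nat \<Rightarrow> int list" where
  "tab K x \<equiv> (if x \<in> set K then tab1 else tab2)"

text \<open>A length \<open>n\<close> between 1 and 14 is encoded by a start phase \<open>s\<close> and an end phase \<open>e = (nxt ^^ n) s\<close>;
  in particular \<open>e = s\<close> encodes the length 14.\<close>

definition seg :: "phase \<Rightarrow> phase \<Rightarrow> phase list" where
  "seg s e = s # takeWhile (\<lambda>t. t \<noteq> e) (succs s)"

text \<open>Let \<open>o\<close> be the number of free positions in an image. A variable of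
  \<open>p2\<close> loses one copy and stores nothing, any other loses two and stores one, so both
  contribute \<open>1 / 2 ^ o\<close>. Scaling by \<open>2 ^ 11\<close> gives integers, as at most
  11 of 14 positions are free.\<close>

definition env_weight :: "nat list \<Rightarrow> (nat \<times> phase \<times> phase) list \<Rightarrow> int" where
  "env_weight K env = prod_list (map (\<lambda>(x, s, e).
     tab K x ! length (tl (seg s e)) * 2 ^ (11 - length (filter is_free (seg s e)))) env)"

text \<open>The symbol \<open>None\<close> marks the boundary between \<open>p1\<close> and \<open>p2\<close>, where the current phase is stored in
  \<open>c\<close>; the list \<open>K\<close> contains the variables of \<open>p2\<close>. The environment records start and end phase of the
  first occurrence of each variable seen so far.\<close>

primrec search :: "nat list \<Rightarrow> (phase \<Rightarrow> int) \<Rightarrow> nat option list \<Rightarrow>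
    (nat \<times> phase \<times> phase) list \<Rightarrow> phase \<Rightarrow> phase \<Rightarrow> int" where
  "search K \<pi> [] env q c = \<pi> c * env_weight K env"
| "search K \<pi> (y # ys) env q c = (case y of
     None \<Rightarrow> search K \<pi> ys env q q
   | Some x \<Rightarrow> (case map_of env x of
       Some (s, e) \<Rightarrow> (case walk s e q of None \<Rightarrow> 0 | Some q' \<Rightarrow> search K \<pi> ys env q' c)
     | None \<Rightarrow> sum_list (map (\<lambda>e. search K \<pi> ys ((x, q, e) # env) e c) (succs q))))"

section \<open>Phases along a word and correctness of the search\<close>

primrec states :: "phase \<Rightarrow> nat \<Rightarrow> phase list" where
  "states q 0 = []"
| "states q (Suc n) = q # states (nxt q) n"

abbreviation bits :: "phase \<Rightarrow> nat \<Rightarrow> bool list" where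
  "bits q n \<equiv> map is_free (states q n)"

lemma length_states [simp]: "length (states q n) = n"
  by (induction n arbitrary: q) auto

lemma states_add: "states q (m + n) = states q m @ states ((nxt ^^ m) q) n"
  by (induction m arbitrary: q) (simp_all add: funpow_swap1)

lemma nxt_period: "(nxt ^^ 14) q = q"
  by (cases q) (simp_all add: numeral_eq_Suc)

lemma nxt_period_mult: "(nxt ^^ (n + 14 * j)) q = (nxt ^^ n) q"
proof (induction j)
  case (Suc j)
  have "(nxt ^^ (a + 14)) q = (nxt ^^ a) q" for a
    by (simp only: funpow_add comp_apply nxt_period)
  from this[of "n + 14 * j"] Suc show ?case by (simp add: algebra_simps)
qed simp

lemma succs_eq: "succs q = map (\<lambda>n. (nxt ^^ n) q) [1..<15]"
  by (induct q) code_simp+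

lemma seg_eq: assumes "1 \<le> n" "n \<le> 14" shows "seg s ((nxt ^^ n) s) = states s n"
proof -
  have "list_all (\<lambda>n. seg s ((nxt ^^ n) s) = states s n) [1..<15]"
    by (induct s) code_simp+
  then show ?thesis using assms by (simp only: list_all_iff set_upt) simp
qed

lemma append_split: "xs @ ys = us @ vs \<Longrightarrow> length xs = length us \<Longrightarrow> xs = us \<and> ys = vs"
  by simp

lemma seg_step: "nxt s \<noteq> e \<Longrightarrow> seg s e = s # seg (nxt s) e"
  by (cases s; cases e) (simp_all add: seg_def)

lemma seg_nxt: "seg s (nxt s) = [s]"
  by (cases s) (simp_all add: seg_def)

lemma walk_seg:
  "walk s e q = (if map is_free (seg s e) = bits q (length (seg s e))
     then Some ((nxt ^^ length (seg s e)) q) else None)"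
proof (induction s e q rule: walk.induct)
  case (1 s e q)
  show ?case
  proof (cases "nxt s = e")
    case True
    then have "seg s e = [s]" using seg_nxt by blast
    then show ?thesis using True by (subst walk.simps) simp
  next
    case False
    show ?thesis
      using 1 False unfolding seg_step[OF False] by (subst walk.simps) (auto simp: funpow_swap1)
  qed
qed

lemma walk_eq:
  assumes "1 \<le> n" "n \<le> 14"
  shows "walk s ((nxt ^^ n) s) q = (if bits s n = bits q n then Some ((nxt ^^ n) q) else None)"
  unfolding walk_seg seg_eq[OF assms] by simp

declare walk.simps [simp del]

lemma sum_PiE_insert:
  fixes f :: "('a \<Rightarrow> 'b) \<Rightarrow> 'c :: comm_monoid_add"
  assumes "x \<notin> V"
  shows "(\<Sum>l\<in>PiE (insert x V) B. f l) = (\<Sum>y\<in>B x. \<Sum>l\<in>PiE V B. f (l(x := y)))"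
proof -
  have "(\<Sum>l\<in>PiE (insert x V) B. f l) = (\<Sum>(y, l)\<in>B x \<times> PiE V B. f (l(x := y)))"
    unfolding PiE_insert_eq by (subst sum.reindex[OF inj_combinator[OF assms]]) (simp add: case_prod_unfold)
  then show ?thesis by (simp add: sum.cartesian_product)
qed

text \<open>The contribution of a single length vector \<open>l\<close> to \<open>search\<close>.\<close>

primrec run_value :: "(nat \<Rightarrow> nat) \<Rightarrow> nat list \<Rightarrow> (phase \<Rightarrow> int) \<Rightarrow> nat option list \<Rightarrow>
    (nat \<times> phase \<times> phase) list \<Rightarrow> phase \<Rightarrow> phase \<Rightarrow> int" where
  "run_value l K \<pi> [] env q c = \<pi> c * env_weight K env"
| "run_value l K \<pi> (y # ys) env q c = (case y of
     None \<Rightarrow> run_value l K \<pi> ys env q q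
   | Some x \<Rightarrow> (case map_of env x of
       Some (s, e) \<Rightarrow> (case walk s e q of None \<Rightarrow> 0 | Some q' \<Rightarrow> run_value l K \<pi> ys env q' c)
     | None \<Rightarrow> run_value l K \<pi> ys ((x, q, (nxt ^^ l x) q) # env) ((nxt ^^ l x) q) c))"

text \<open>The length of a variable already in the environment is encoded by its two phases and no
  longer looked up. This lets the summation over a new variable be split off.\<close>

lemma run_value_cong:
  "(\<And>x. Some x \<in> set ys \<Longrightarrow> x \<notin> fst ` set env \<Longrightarrow> l x = l' x) \<Longrightarrow>
    run_value l K \<pi> ys env q c = run_value l' K \<pi> ys env q c"
proof (induction ys arbitrary: env q c)
  case (Cons y ys)
  show ?case
  proof (cases y)
    case None
    then show ?thesis using Cons by simp
  next
    case (Some x)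
    show ?thesis
    proof (cases "map_of env x")
      case None
      then have "x \<notin> fst ` set env" by (simp add: map_of_eq_None_iff)
      then have "l x = l' x" using Cons.prems Some by simp
      moreover have "run_value l K \<pi> ys ((x, q, e) # env) e c = run_value l' K \<pi> ys ((x, q, e) # env) e c" for e
        by (rule Cons.IH) (use Cons.prems in auto)
      ultimately show ?thesis using None Some by simp
    next
      case (Some se)
      have "run_value l K \<pi> ys env q' c = run_value l' K \<pi> ys env q' c" for q'
        by (rule Cons.IH) (use Cons.prems in auto)
      then show ?thesis using Some \<open>y = Some x\<close> by (simp split: option.split prod.split)
    qed
  qed
qed simp

text \<open>Branching over \<open>succs q\<close> at a new variable is summation over its length,
  because this list contains the phases after 1 to 14 steps.\<close>

lemma search_eq_sum:
  "search K \<pi> ys env q c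
    = (\<Sum>l\<in>PiE ({x. Some x \<in> set ys} - fst ` set env) (\<lambda>_. {1..14}). run_value l K \<pi> ys env q c)"
proof (induction ys arbitrary: env q c)
  case Nil
  then show ?case by simp
next
  case (Cons y ys)
  show ?case
  proof (cases y)
    case None
    then show ?thesis using Cons by simp
  next
    case y: (Some x)
    show ?thesis
    proof (cases "map_of env x")
      case (Some se)
      obtain s e where se: "se = (s, e)" by (cases se)
      have "x \<in> fst ` set env" using Some by (force dest: map_of_SomeD)
      then have A: "{z. Some z \<in> set (y # ys)} - fst ` set env = {z. Some z \<in> set ys} - fst ` set env"
        using y by auto
      show ?thesis
        unfolding A using Cons y Some se by (simp split: option.split)
    next
      case None
      let ?A = "{z. Some z \<in> set ys} - fst ` set ((x, q, q) # env)"
      have x: "x \<notin> fst ` set env" using None by (simp add: map_of_eq_None_iff)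
      then have A: "{z. Some z \<in> set (y # ys)} - fst ` set env = insert x ?A" using y by auto
      have "run_value (l(x := n)) K \<pi> (y # ys) env q c
          = run_value l K \<pi> ys ((x, q, (nxt ^^ n) q) # env) ((nxt ^^ n) q) c" for l n
      proof -
        have "run_value (l(x := n)) K \<pi> ys env' q' c = run_value l K \<pi> ys env' q' c"
          if "x \<in> fst ` set env'" for env' q'
          by (rule run_value_cong) (use that in auto)
        then show ?thesis using y None by simp
      qed
      then have "(\<Sum>l\<in>PiE (insert x ?A) (\<lambda>_. {1..14}). run_value l K \<pi> (y # ys) env q c)
          = (\<Sum>n\<in>{1..14}. \<Sum>l\<in>PiE ?A (\<lambda>_. {1..14}).
              run_value l K \<pi> ys ((x, q, (nxt ^^ n) q) # env) ((nxt ^^ n) q) c)"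
        by (subst sum_PiE_insert) auto
      also have "\<dots> = (\<Sum>n\<in>{1..14}. search K \<pi> ys ((x, q, (nxt ^^ n) q) # env) ((nxt ^^ n) q) c)"
        by (rule sum.cong) (simp_all add: Cons.IH)
      also have "\<dots> = (\<Sum>n\<leftarrow>[1..<15]. search K \<pi> ys ((x, q, (nxt ^^ n) q) # env) ((nxt ^^ n) q) c)"
        by (subst sum_list_distinct_conv_sum_set) (auto intro!: sum.cong)
      also have "\<dots> = search K \<pi> (y # ys) env q c"
        using y None by (simp add: succs_eq comp_def)
      finally show ?thesis unfolding A by simp
    qed
  qed
qed

definition env_ok :: "(nat \<Rightarrow> bool list) \<Rightarrow> (nat \<Rightarrow> nat) \<Rightarrow> (nat \<times> phase \<times> phase) list \<Rightarrow> bool" where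
  "env_ok u l env \<longleftrightarrow> distinct (map fst env) \<and>
     (\<forall>(x, s, e)\<in>set env. e = (nxt ^^ l x) s \<and> u x = bits s (l x) \<and> 1 \<le> l x \<and> l x \<le> 14)"

text \<open>When \<open>u\<close> factorises the binary word read from \<open>q\<close>, every
  \<open>walk\<close> succeeds and no branch value 0 arises. The rest \<open>r\<close> is kept
  general so that the runs through \<open>p1\<close> and \<open>p2\<close> can be joined at the
  marker.\<close>

lemma run_value_run:
  assumes "concat (map u p) = bits q (len l p)" and "\<And>x. x \<in> set p \<Longrightarrow> length (u x) = l x"
    and "\<And>x. x \<in> set p \<Longrightarrow> 1 \<le> l x \<and> l x \<le> 14" and "env_ok u l env"
  shows "\<exists>env'. env_ok u l env' \<and> fst ` set env' = fst ` set env \<union> set p \<and>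
    run_value l K \<pi> (map Some p @ r) env q c = run_value l K \<pi> r env' ((nxt ^^ len l p) q) c"
  using assms
proof (induction p arbitrary: env q)
  case Nil
  then show ?case by (intro exI[of _ env]) simp
next
  case (Cons x p)
  let ?q = "(nxt ^^ l x) q"
  have split: "bits q (len l (x # p)) = bits q (l x) @ bits ?q (len l p)"
    by (simp add: states_add)
  then have "u x @ concat (map u p) = bits q (l x) @ bits ?q (len l p)" using Cons.prems(1) by simp
  moreover have "length (u x) = length (bits q (l x))" using Cons.prems(2) by simp
  ultimately have *: "u x = bits q (l x) \<and> concat (map u p) = bits ?q (len l p)"
    by (rule append_split)
  note u = conjunct1[OF *] and rest = conjunct2[OF *]
  have lx: "1 \<le> l x" "l x \<le> 14" using Cons.prems(3)[of x] by auto
  define env2 where "env2 = (if x \<in> fst ` set env then env else (x, q, ?q) # env)"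
  have ok2: "env_ok u l env2"
    using Cons.prems(4) u lx by (auto simp: env2_def env_ok_def)
  have "run_value l K \<pi> (map Some (x # p) @ r) env q c = run_value l K \<pi> (map Some p @ r) env2 ?q c"
  proof (cases "map_of env x")
    case None
    then have "x \<notin> fst ` set env" by (simp add: map_of_eq_None_iff)
    then show ?thesis using None by (simp add: env2_def)
  next
    case (Some se)
    obtain s e where se: "se = (s, e)" by (cases se)
    have "(x, s, e) \<in> set env" using Some se by (auto dest: map_of_SomeD)
    then have "e = (nxt ^^ l x) s" "u x = bits s (l x)" "x \<in> fst ` set env"
      using Cons.prems(4) by (force simp: env_ok_def)+
    then have "walk s e q = Some ?q" using walk_eq[OF lx, of s q] u by simp
    then show ?thesis using Some se \<open>x \<in> fst ` set env\<close> by (simp add: env2_def)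
  qed
  moreover obtain env' where "env_ok u l env'" "fst ` set env' = fst ` set env2 \<union> set p"
    "run_value l K \<pi> (map Some p @ r) env2 ?q c = run_value l K \<pi> r env' ((nxt ^^ len l p) ?q) c"
    using Cons.IH[OF rest _ _ ok2] Cons.prems(2,3) by auto
  moreover have "fst ` set env2 \<union> set p = fst ` set env \<union> set (x # p)" by (auto simp: env2_def)
  moreover have "(nxt ^^ len l p) ?q = (nxt ^^ len l (x # p)) q"
  proof -
    have "(nxt ^^ len l p) ?q = (nxt ^^ (len l p + l x)) q" by (simp only: funpow_add comp_apply)
    also have "len l p + l x = len l (x # p)" by simp
    finally show ?thesis .
  qed
  ultimately show ?case by (intro exI[of _ env']) simp
qed

lemma env_weight_eq:
  assumes "env_ok u l env"
  shows "env_weight K env = (\<Prod>x\<in>fst ` set env. tab K x ! (l x - 1) * 2 ^ (11 - count_list (u x) True))"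
  using assms
proof (induction env)
  case Nil
  then show ?case by (simp add: env_weight_def)
next
  case (Cons a env)
  obtain x s e where a: "a = (x, s, e)" by (cases a)
  have x: "e = (nxt ^^ l x) s" "u x = bits s (l x)" "1 \<le> l x" "l x \<le> 14" "x \<notin> fst ` set env"
    and ok: "env_ok u l env" using Cons.prems a by (auto simp: env_ok_def)
  have "length (filter is_free (states s n)) = count_list (bits s n) True" for s n
    by (induction n arbitrary: s) auto
  then have "env_weight K (a # env) = (tab K x ! (l x - 1) * 2 ^ (11 - count_list (u x) True)) * env_weight K env"
    using x by (simp add: env_weight_def a seg_eq)
  then show ?case using Cons.IH[OF ok] x(5) a by simp
qed

lemma run_value_full:
  assumes u: "concat (map u (p1 @ p2)) = bits q (len l (p1 @ p2))"
    and len: "\<And>x. x \<in> set (p1 @ p2) \<Longrightarrow> length (u x) = l x"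
    and l: "\<And>x. x \<in> set (p1 @ p2) \<Longrightarrow> 1 \<le> l x \<and> l x \<le> 14"
  shows "run_value l K \<pi> (map Some p1 @ None # map Some p2) [] q c
    = \<pi> ((nxt ^^ len l p1) q) *
      (\<Prod>x\<in>set (p1 @ p2). tab K x ! (l x - 1) * 2 ^ (11 - count_list (u x) True))"
proof -
  let ?q = "(nxt ^^ len l p1) q"
  have "concat (map u p1) @ concat (map u p2) = bits q (len l p1) @ bits ?q (len l p2)"
    using u by (simp add: states_add)
  moreover have "length (concat (map u p1)) = length (bits q (len l p1))"
    unfolding length_concat_map using len by (simp cong: map_cong)
  ultimately have *: "concat (map u p1) = bits q (len l p1) \<and> concat (map u p2) = bits ?q (len l p2)"
    by (rule append_split)
  note c = conjunct1[OF *] conjunct2[OF *]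
  have "env_ok u l []" by (simp add: env_ok_def)
  from run_value_run[OF c(1) _ _ this, of K \<pi> "None # map Some p2" c] obtain env1 where
    1: "env_ok u l env1" "fst ` set env1 = set p1"
      "run_value l K \<pi> (map Some p1 @ None # map Some p2) [] q c
        = run_value l K \<pi> (None # map Some p2) env1 ?q c"
    using len l by auto
  from run_value_run[OF c(2) _ _ 1(1), of K \<pi> "[]" ?q] obtain env2 where
    2: "env_ok u l env2" "fst ` set env2 = set p1 \<union> set p2"
      "run_value l K \<pi> (map Some p2) env1 ?q ?q
        = run_value l K \<pi> [] env2 ((nxt ^^ len l p2) ?q) ?q"
    using len l 1(2) by auto
  show ?thesis using 1(3) 2(3) env_weight_eq[OF 2(1), of K] 2(2) by simp
qed

section \<open>Reduction of the lengths to one period\<close>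

lemma sum_periodic_le:
  fixes h :: "nat \<Rightarrow> real"
  assumes nn: "\<And>y. 0 \<le> h y" and shift: "\<And>y. 1 \<le> y \<Longrightarrow> h (y + m) \<le> Q * h y" and Q: "Q < 1"
  shows "(\<Sum>y=1..n. h y) \<le> 1 / (1 - Q) * (\<Sum>y=1..m. h y)"
proof -
  \<comment> \<open>Indices above \<open>m\<close> are shifts of smaller ones, so the sum is at most
    the sum over one period plus \<open>Q\<close> times itself; this is solved for the sum.\<close>
  have "{1..n} \<subseteq> {1..m} \<union> (\<lambda>y. y + m) ` {1..n}"
  proof
    fix y assume "y \<in> {1..n}"
    then show "y \<in> {1..m} \<union> (\<lambda>y. y + m) ` {1..n}"
      by (cases "y \<le> m") (auto intro!: image_eqI[of _ _ "y - m"])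
  qed
  then have "(\<Sum>y=1..n. h y) \<le> (\<Sum>y\<in>{1..m} \<union> (\<lambda>y. y + m) ` {1..n}. h y)"
    using nn by (intro sum_mono2) auto
  also have "\<dots> \<le> (\<Sum>y=1..m. h y) + (\<Sum>y\<in>(\<lambda>y. y + m) ` {1..n}. h y)"
    using nn sum.union_inter[of "{1..m}" "(\<lambda>y. y + m) ` {1..n}" h] sum_nonneg[of "{1..m} \<inter> (\<lambda>y. y + m) ` {1..n}" h]
    by simp
  also have "(\<Sum>y\<in>(\<lambda>y. y + m) ` {1..n}. h y) = (\<Sum>y=1..n. h (y + m))"
    by (subst sum.reindex) (auto simp: inj_on_def)
  also have "\<dots> \<le> (\<Sum>y=1..n. Q * h y)" by (intro sum_mono shift) simp
  also have "\<dots> = Q * (\<Sum>y=1..n. h y)" by (simp only: sum_distrib_left)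
  finally have "(1 - Q) * (\<Sum>y=1..n. h y) \<le> (\<Sum>y=1..m. h y)"
    by (simp only: left_diff_distrib mult_1 diff_le_eq)
  then have "(\<Sum>y=1..n. h y) \<le> (\<Sum>y=1..m. h y) / (1 - Q)"
    using Q by (simp only: pos_le_divide_eq diff_gt_0_iff_gt mult.commute)
  then show ?thesis by simp
qed

lemma sum_PiE_periodic_le:
  fixes H :: "('v \<Rightarrow> nat) \<Rightarrow> real"
  assumes "finite V" and "Q < 1" and "\<And>l. 0 \<le> H l"
    and "\<And>X l. X \<in> V \<Longrightarrow> H (l(X := l X + m)) \<le> Q * H l"
  shows "(\<Sum>l\<in>PiE V (\<lambda>_. {1..n}). H l) \<le> (1 / (1 - Q)) ^ card V * (\<Sum>l\<in>PiE V (\<lambda>_. {1..m}). H l)"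
  using assms
proof (induction V arbitrary: H rule: finite_induct)
  case (insert x V)
  let ?\<kappa> = "1 / (1 - Q)"
  have "(\<Sum>l\<in>PiE (insert x V) (\<lambda>_. {1..n}). H l)
      = (\<Sum>y=1..n. \<Sum>l\<in>PiE V (\<lambda>_. {1..n}). H (l(x := y)))"
    by (rule sum_PiE_insert[OF insert.hyps(2)])
  also have "\<dots> \<le> (\<Sum>y=1..n. ?\<kappa> ^ card V * (\<Sum>l\<in>PiE V (\<lambda>_. {1..m}). H (l(x := y))))"
  proof (rule sum_mono)
    fix y
    show "(\<Sum>l\<in>PiE V (\<lambda>_. {1..n}). H (l(x := y)))
        \<le> ?\<kappa> ^ card V * (\<Sum>l\<in>PiE V (\<lambda>_. {1..m}). H (l(x := y)))"
    proof (rule insert.IH[of "\<lambda>l. H (l(x := y))"])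
      fix X l assume X: "X \<in> V"
      then have "X \<noteq> x" using insert.hyps(2) by auto
      then have "(l(X := l X + m))(x := y) = (l(x := y))(X := (l(x := y)) X + m)"
        by (simp add: fun_upd_twist)
      then show "H ((l(X := l X + m))(x := y)) \<le> Q * H (l(x := y))"
        using insert.prems(3)[OF insertI2[OF X], of "l(x := y)"] by (simp only:)
    qed (use insert.prems in auto)
  qed
  also have "\<dots> = ?\<kappa> ^ card V * (\<Sum>l\<in>PiE V (\<lambda>_. {1..m}). \<Sum>y=1..n. H (l(x := y)))"
    by (subst sum.swap) (simp only: sum_distrib_left)
  also have "\<dots> \<le> ?\<kappa> ^ card V * (\<Sum>l\<in>PiE V (\<lambda>_. {1..m}). ?\<kappa> * (\<Sum>y=1..m. H (l(x := y))))"
  proof (intro mult_left_mono sum_mono sum_periodic_le)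
    fix l y
    show "H (l(x := y + m)) \<le> Q * H (l(x := y))" 
      using insert.prems(3)[OF insertI1, of "l(x := y)"] by (simp only: fun_upd_upd fun_upd_same)
  qed (use insert.prems in auto)
  also have "\<dots> = ?\<kappa> ^ card (insert x V) * (\<Sum>y=1..m. \<Sum>l\<in>PiE V (\<lambda>_. {1..m}). H (l(x := y)))"
    using insert.hyps by (subst sum.swap) (simp add: sum_distrib_left mult.assoc)
  also have "(\<Sum>y=1..m. \<Sum>l\<in>PiE V (\<lambda>_. {1..m}). H (l(x := y)))
      = (\<Sum>l\<in>PiE (insert x V) (\<lambda>_. {1..m}). H l)"
    by (rule sum_PiE_insert[OF insert.hyps(2), symmetric])
  finally show ?case .
qed simp

lemma len_shift: "len (l(X := l X + m)) u = len l u + m * count_list u X"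
  by (induction u) auto

lemma bits_block:
  assumes "concat (map u (a @ X # c)) = bits q (len l (a @ X # c))"
    and "\<And>Y. Y \<in> set (a @ X # c) \<Longrightarrow> length (u Y) = l Y"
  shows "u X = bits ((nxt ^^ len l a) q) (l X)"
proof -
  let ?q = "(nxt ^^ len l a) q"
  have "concat (map u a) @ (u X @ concat (map u c)) = bits q (len l a) @ bits ?q (l X + len l c)"
    using assms(1) by (simp add: states_add)
  moreover have "length (concat (map u a)) = length (bits q (len l a))"
    unfolding length_concat_map using assms(2) by (simp cong: map_cong)
  ultimately have *: "concat (map u a) = bits q (len l a) \<and> u X @ concat (map u c) = bits ?q (l X + len l c)"
    by (rule append_split)
  have "u X @ concat (map u c) = bits ?q (l X) @ bits ((nxt ^^ l X) ?q) (len l c)"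
    using * by (simp add: states_add)
  moreover have "length (u X) = length (bits ?q (l X))" using assms(2)[of X] by simp
  ultimately show "u X = bits ?q (l X)" using append_split by metis
qed

text \<open>Removing a full period from every image of \<open>X\<close> keeps the phase at each
  block boundary, so the shortened images still factorise the periodic binary word.\<close>

lemma bits_shorten:
  assumes "concat (map u p) = bits q (len (l(X := l X + 14)) p)"
    and "\<And>Y. Y \<in> set p \<Longrightarrow> length (u Y) = (l(X := l X + 14)) Y"
  shows "concat (map (u(X := take (l X) (u X))) p) = bits q (len l p)"
  using assms
proof (induction p arbitrary: q)
  case (Cons Y p)
  let ?l = "l(X := l X + 14)"
  let ?u = "u(X := take (l X) (u X))"
  have "u Y @ concat (map u p) = bits q (?l Y) @ bits ((nxt ^^ ?l Y) q) (len ?l p)"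
    using Cons.prems(1) by (simp add: states_add del: fun_upd_apply)
  moreover have "length (u Y) = length (bits q (?l Y))" using Cons.prems(2)[of Y] by simp
  ultimately have *: "u Y = bits q (?l Y) \<and> concat (map u p) = bits ((nxt ^^ ?l Y) q) (len ?l p)"
    by (rule append_split)
  have "(nxt ^^ ?l Y) q = (nxt ^^ l Y) q" using nxt_period_mult[of "l Y" 1 q] by auto
  moreover have "concat (map ?u p) = bits ((nxt ^^ ?l Y) q) (len l p)"
  proof (rule Cons.IH)
    show "concat (map u p) = bits ((nxt ^^ ?l Y) q) (len ?l p)" using * by (rule conjunct2)
    show "length (u Z) = ?l Z" if "Z \<in> set p" for Z by (rule Cons.prems(2)) (simp add: that)
  qed
  moreover have "?u Y = bits q (l Y)"
  proof (cases "Y = X")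
    case True
    have "take (l X) (bits q (l X + 14)) = bits q (l X)" by (simp add: states_add)
    then show ?thesis using * True by simp
  qed (use * in simp)
  ultimately show ?case by (simp add: states_add del: fun_upd_apply)
qed simp

lemma ones_period: "count_list (bits q 14) True = 11"
  by (induct q) code_simp+

lemma ones_add_period: "count_list (bits q (n + 14 * j)) True = count_list (bits q n) True + 11 * j"
proof (induction j)
  case (Suc j)
  have "bits q (n + 14 * Suc j) = bits q (n + 14 * j) @ bits ((nxt ^^ (n + 14 * j)) q) 14"
    using states_add[of q "n + 14 * j" 14] by (simp add: algebra_simps)
  then show ?case using Suc by (simp only: count_list_append ones_period) simp
qed simp

lemma ones_le: assumes "n \<le> 14" shows "count_list (bits q n) True \<le> 11"
proof -
  have "bits q 14 = bits q n @ bits ((nxt ^^ n) q) (14 - n)" using assms states_add[of q n "14 - n"] by simp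
  then show ?thesis using ones_period[of q] by (simp only: count_list_append)
qed

lemma tab1_ge: "1 \<le> n \<Longrightarrow> n \<le> 14 \<Longrightarrow> (109/100 :: real) ^ n \<le> tab1 ! (n - 1) / 1000"
proof -
  have "\<forall>n\<in>{1..<15}. (109/100 :: real) ^ n \<le> tab1 ! (n - 1) / 1000"
    unfolding atLeastLessThan_upt by (simp add: upt_rec tab1_def power_divide nth_Cons')
  then show "1 \<le> n \<Longrightarrow> n \<le> 14 \<Longrightarrow> (109/100 :: real) ^ n \<le> tab1 ! (n - 1) / 1000" by simp
qed

lemma tab2_ge: "1 \<le> n \<Longrightarrow> n \<le> 14 \<Longrightarrow> (109/100 :: real) ^ (2 * n) \<le> tab2 ! (n - 1) / 1000"
proof -
  have "\<forall>n\<in>{1..<15}. (109/100 :: real) ^ (2 * n) \<le> tab2 ! (n - 1) / 1000"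
    unfolding atLeastLessThan_upt by (simp add: upt_rec tab2_def power_divide nth_Cons')
  then show "1 \<le> n \<Longrightarrow> n \<le> 14 \<Longrightarrow> (109/100 :: real) ^ (2 * n) \<le> tab2 ! (n - 1) / 1000" by simp
qed

lemma length_seg: "length (tl (seg s e)) < 14"
  by (cases s; cases e) (simp_all add: seg_def)

lemma env_weight_nonneg: "0 \<le> env_weight K env"
proof -
  have "\<forall>t\<in>set tab1. 0 \<le> t" "\<forall>t\<in>set tab2. 0 \<le> t" "length tab1 = 14" "length tab2 = 14"
    by (simp_all add: tab1_def tab2_def)
  then have "0 \<le> tab K x ! length (tl (seg s e))" for x s e
    using length_seg[of s e] by (metis nth_mem)
  then show ?thesis
    unfolding env_weight_def by (intro prod_list_nonneg) (auto simp del: length_tl)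
qed

lemma run_value_nonneg: "(\<And>q. 0 \<le> \<pi> q) \<Longrightarrow> 0 \<le> run_value l K \<pi> ys env q c"
  by (induction ys arbitrary: env q c) (auto simp: env_weight_nonneg split: option.split)

text \<open>The weights are \<open>wt q = card (C q) * \<pi> q / (1.09 * \<pi> (nxt q))\<close>, for which the summability condition
  becomes linear in \<open>\<pi>\<close>. Lengthening an image by a period multiplies a weight by at most
  \<open>Q = 1.09 ^ 28 / 2 ^ 11\<close>, so lengths up to 14 suffice at the cost of a factor
  \<open>1 / (1 - Q) \<le> 2011 / 2000\<close> per variable. In integers the scale is \<open>4096000000 = 2000 * 2048 * 1000\<close>,
  where 2048 and 1000 are the scales of the powers of 2 and of the tables.\<close>

lemma GR_ge_periodic:
  fixes p1 p2 :: "nat list" and \<pi> :: "phase \<Rightarrow> int"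
  assumes \<pi>: "\<And>q. \<pi> q > 0" and p1: "p1 \<noteq> []"
    and cnt: "\<And>X. X \<in> set (p1 @ p2) \<Longrightarrow> count_list p1 X = (if X \<in> set p2 then 1 else 2)"
    and chk: "\<And>q. 100 * 2011 ^ card (set (p1 @ p2)) *
        search p2 \<pi> (map Some p1 @ None # map Some p2) [] q q
      \<le> (109 * \<pi> (nxt q) - 100 * \<pi> q) * 4096000000 ^ card (set (p1 @ p2))"
  shows "79/50 \<le> GR 3 (p1 @ p2)"
proof -
  define C :: "phase \<Rightarrow> nat set" where "C q = (if is_free q then {1, 2} else {0})" for q
  define g :: real where "g = 109/100"
  define wt where "wt q = real (card (C q)) * \<pi> q / (g * \<pi> (nxt q))" for q
  \<comment> \<open>Sending 0 to \<open>False\<close> and 1, 2 to \<open>True\<close> maps an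
    occurrence of \<open>p\<close> to a factorisation of the periodic binary word. Only the
    existence of such binary images with lengths \<open>l\<close> is demanded.\<close>
  define feas where "feas q l \<longleftrightarrow> (\<exists>u. (\<forall>X\<in>set (p1 @ p2). length (u X) = l X) \<and>
    concat (map u (p1 @ p2)) = bits q (len l (p1 @ p2)))" for q and l :: "nat \<Rightarrow> nat"
  have g: "g > 0" by (simp add: g_def)
  have cardC: "card (C q) = 2 ^ (if is_free q then 1 else 0)" for q by (simp add: C_def)
  interpret counting nxt C p1 p2 wt feas
    by unfold_locales (use p1 \<pi> g in \<open>auto simp: C_def wt_def\<close>)
  have p: "p = p1 @ p2" by (rule p_def)
  let ?V = "set p1 - set p2" and ?k = "card (set p)"
  let ?ps = "map Some p1 @ None # map Some p2"
  have num_words: "num_words q n = 2 ^ count_list (bits q n) True" for q n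
  proof (induction n arbitrary: q)
    case (Suc n)
    then show ?case by (simp add: num_words_Suc cardC)
  qed (simp add: num_words_def)
  \<comment> \<open>The quotients of \<open>\<pi>\<close> in the weights telescope.\<close>
  have wprod: "wprod q n = 2 ^ count_list (bits q n) True * \<pi> q / (g ^ n * \<pi> ((nxt ^^ n) q))" for q n
  proof (induction n arbitrary: q)
    case 0
    then show ?case using \<pi>[of q] by (simp add: wprod_def)
  next
    case (Suc n)
    have "wprod q (Suc n) = wt q * (2 ^ count_list (bits (nxt q) n) True * \<pi> (nxt q)
        / (g ^ n * \<pi> ((nxt ^^ n) (nxt q))))" unfolding wprod_Suc Suc ..
    also have "\<dots> = 2 ^ count_list (bits q (Suc n)) True * \<pi> q / (g ^ Suc n * \<pi> ((nxt ^^ Suc n) q))"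
      using \<pi>[of "nxt q"] g by (simp add: wt_def cardC funpow_swap1 mult_ac)
    finally show ?case .
  qed
  have fits_bits: "map (\<lambda>a. a \<noteq> 0) w = bits q (length w)" if "fits q w" for q w
    using that by (induction w arbitrary: q) (auto simp: C_def split: if_splits)
  have feasible: "feas q (restrict (\<lambda>X. length (f X)) (set p))"
    if ft: "fits q w" and pre: "prefix (concat (map f p)) w" for q w f
  proof -
    let ?l = "restrict (\<lambda>X. length (f X)) (set p)"
    define u where "u X = map (\<lambda>a. a \<noteq> 0) (f X)" for X
    obtain z where z: "w = concat (map f p) @ z" using pre by (auto simp: prefix_def)
    have len: "len ?l p = length (concat (map f p))"
      unfolding length_concat_map by (rule len_cong) simp
    have "concat (map u p) @ map (\<lambda>a. a \<noteq> 0) z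
        = bits q (len ?l p) @ bits ((nxt ^^ len ?l p) q) (length z)"
      using fits_bits[OF ft] unfolding z len
      by (simp add: states_add map_concat comp_def u_def[abs_def])
    moreover have "length (concat (map u p)) = length (bits q (len ?l p))"
      unfolding len length_concat_map by (simp add: u_def)
    ultimately have "concat (map u p) = bits q (len ?l p)" using append_split by metis
    then show ?thesis unfolding feas_def by (intro exI[of _ u]) (simp add: p u_def)
  qed
  \<comment> \<open>Infeasible vectors get the value 0, so the sum runs over a full product of
    intervals and can be treated one coordinate at a time.\<close>
  define H where "H q l = (if feas q l then free_words q l / wprod q (len l p1) else 0)" for q l
  define Q where "Q = g ^ 28 / 2 ^ 11"
  have H_nn: "0 \<le> H q l" for q l using wprod_pos[of q "len l p1"] by (simp add: H_def)
  have H_shift: "H q (l(X := l X + 14)) \<le> Q * H q l" if X: "X \<in> set p" for q X l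
  proof (cases "feas q (l(X := l X + 14))")
    case False
    then show ?thesis using H_nn[of q l] g by (simp add: H_def Q_def)
  next
    case True
    let ?l = "l(X := l X + 14)"
    obtain u where u: "\<forall>Y\<in>set (p1 @ p2). length (u Y) = ?l Y"
      "concat (map u (p1 @ p2)) = bits q (len ?l (p1 @ p2))" using True unfolding feas_def by blast
    have "concat (map (u(X := take (l X) (u X))) (p1 @ p2)) = bits q (len l (p1 @ p2))"
      by (rule bits_shorten[OF u(2)]) (use u(1) in auto)
    moreover have "\<forall>Y\<in>set (p1 @ p2). length ((u(X := take (l X) (u X))) Y) = l Y"
      using u(1) by auto
    ultimately have feas: "feas q l" unfolding feas_def by blast
    have off: "(nxt ^^ offset ?l Y) q = (nxt ^^ offset l Y) q" for Y
      unfolding offset_def len_shift nxt_period_mult ..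
    have nw: "num_words s (n + 14) = num_words s n * 2 ^ 11" for s n
      using ones_add_period[of s n 1] by (simp add: num_words power_add)
    have "free_words q ?l = (\<Prod>Y\<in>?V. num_words ((nxt ^^ offset l Y) q) (l Y) * (if Y = X then 2 ^ 11 else 1))"
      unfolding free_words_def off by (rule prod.cong) (auto simp: nw)
    also have "\<dots> = free_words q l * (if X \<in> ?V then 2 ^ 11 else 1)"
      by (simp add: prod.distrib free_words_def)
    finally have fw: "free_words q ?l = free_words q l * (if X \<in> ?V then 2 ^ 11 else 1)" .
    have "wprod q (n + 14 * j) = wprod q n * (2 ^ 11 / g ^ 14) ^ j" for n j
      unfolding wprod ones_add_period nxt_period_mult
      by (simp add: power_add power_mult power_divide) (simp only: mult_ac)
    then have wp: "wprod q (len ?l p1) = wprod q (len l p1) * (2 ^ 11 / g ^ 14) ^ count_list p1 X"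
      unfolding len_shift by simp
    \<comment> \<open>If \<open>X\<close> occurs in \<open>p2\<close>, the left side is
      \<open>g ^ 14 / 2 ^ 11\<close>; otherwise two deleted copies and one stored image give exactly
      \<open>Q\<close>.\<close>
    have "(if X \<in> ?V then 2 ^ 11 else 1) / (2 ^ 11 / g ^ 14) ^ count_list p1 X \<le> Q"
      using cnt[of X] X unfolding p Q_def g_def by (auto simp: power_divide power2_eq_square)
    moreover have "H q ?l = ((if X \<in> ?V then 2 ^ 11 else 1) / (2 ^ 11 / g ^ 14) ^ count_list p1 X) * H q l"
      using True feas by (simp add: H_def fw wp mult_ac)
    ultimately show ?thesis using H_nn[of q l] by (simp only: mult_right_mono)
  qed
  have H_le: "H q l \<le> run_value l p2 \<pi> ?ps [] q q / (2048000 ^ ?k * \<pi> q)"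
    if l: "l \<in> PiE (set p) (\<lambda>_. {1..14})" for q l
  proof (cases "feas q l")
    case False
    have "0 \<le> run_value l p2 \<pi> ?ps [] q q" by (rule run_value_nonneg) (use \<pi> in \<open>simp add: less_imp_le\<close>)
    then show ?thesis using False \<pi>[of q] by (simp add: H_def)
  next
    case True
    then obtain u where len: "\<forall>X\<in>set (p1 @ p2). length (u X) = l X"
      and u: "concat (map u (p1 @ p2)) = bits q (len l (p1 @ p2))" unfolding feas_def by blast
    define o' where "o' X = count_list (u X) True" for X
    have l14: "1 \<le> l X" "l X \<le> 14" if "X \<in> set p" for X using l that by (auto simp: PiE_iff)
    have uX: "u X = bits ((nxt ^^ len l a) q) (l X)" if "p1 @ p2 = a @ X # c" for a X c
      using bits_block[of u a X c q l] u len that by simp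
    have off: "num_words ((nxt ^^ offset l X) q) (l X) = 2 ^ o' X" if X: "X \<in> ?V" for X
    proof -
      obtain c where "p1 = takeWhile (\<lambda>Y. Y \<noteq> X) p1 @ X # c" using X split_at_first[of X p1] by auto
      then have "p1 @ p2 = takeWhile (\<lambda>Y. Y \<noteq> X) p1 @ X # (c @ p2)" by (metis append.assoc append_Cons)
      from uX[OF this] show ?thesis by (simp add: num_words o'_def offset_def)
    qed
    have o11: "o' X \<le> 11" if X: "X \<in> set p" for X
    proof -
      obtain a c where "p1 @ p2 = a @ X # c" using X unfolding p by (meson split_list)
      from uX[OF this] show ?thesis unfolding o'_def using ones_le l14[OF X] by simp
    qed
    have o1: "count_list (bits q (len l p1)) True = (\<Sum>X\<in>set p. count_list p1 X * o' X)"
    proof -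
      have ones: "count_list (concat (map u v)) True = len o' v" for v
        by (induction v) (simp_all add: count_list_append o'_def)
      have c: "concat (map u p1) = bits q (len l p1)"
      proof -
        have "concat (map u p1) @ concat (map u p2) = bits q (len l p1) @ bits ((nxt ^^ len l p1) q) (len l p2)"
          using u by (simp add: states_add)
        moreover have "length (concat (map u p1)) = length (bits q (len l p1))"
          unfolding length_concat_map using len by (simp cong: map_cong)
        ultimately show ?thesis using append_split by metis
      qed
      have "len o' p1 = (\<Sum>X\<in>set p. count_list p1 X * o' X)" by (rule len_eq_sum) (auto simp: p)
      with ones[of p1] show ?thesis unfolding c by (rule trans)
    qed
    have l1: "len l p1 = (\<Sum>X\<in>set p. count_list p1 X * l X)" by (rule len_eq_sum) (auto simp: p)
    define e where "e = (nxt ^^ len l p1) q"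
    have "real (free_words q l) = (\<Prod>X\<in>set p. if X \<in> ?V then 2 ^ o' X else 1)"
    proof -
      have "real (free_words q l) = (\<Prod>X\<in>?V. 2 ^ o' X)" by (simp add: free_words_def off)
      also have "\<dots> = (\<Prod>X\<in>set p. if X \<in> ?V then 2 ^ o' X else 1)"
        by (rule prod.mono_neutral_cong_left) (auto simp: p)
      finally show ?thesis .
    qed
    then have "H q l = (\<Prod>X\<in>set p. if X \<in> ?V then 2 ^ o' X else 1) /
        (2 ^ (\<Sum>X\<in>set p. count_list p1 X * o' X) * \<pi> q / (g ^ (\<Sum>X\<in>set p. count_list p1 X * l X) * \<pi> e))"
      using True unfolding H_def wprod o1 e_def by (simp add: l1)
    also have "\<dots> = (\<Prod>X\<in>set p. (if X \<in> ?V then 2 ^ o' X else 1)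
        * g ^ (count_list p1 X * l X) / 2 ^ (count_list p1 X * o' X)) * \<pi> e / \<pi> q"
      by (simp add: power_sum prod.distrib prod_dividef)
    also have "\<dots> \<le> (\<Prod>X\<in>set p. real_of_int (tab p2 X ! (l X - 1) * 2 ^ (11 - o' X)) / 2048000) * \<pi> e / \<pi> q"
    proof (intro divide_right_mono mult_right_mono prod_mono conjI)
      fix X assume X: "X \<in> set p"
      have "(if X \<in> ?V then 2 ^ o' X else 1) * g ^ (count_list p1 X * l X) / 2 ^ (count_list p1 X * o' X)
          = g ^ (count_list p1 X * l X) / 2 ^ o' X"
        using cnt[of X] X by (auto simp: p mult_2 power_add)
      also have "\<dots> \<le> real_of_int (tab p2 X ! (l X - 1)) / 1000 / 2 ^ o' X"
        using tab1_ge[OF l14[OF X]] tab2_ge[OF l14[OF X]] cnt[of X] X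
        by (intro divide_right_mono) (auto simp: p g_def)
      also have "\<dots> = real_of_int (tab p2 X ! (l X - 1) * 2 ^ (11 - o' X)) / 2048000"
      proof -
        have "(2 :: real) ^ (11 - o' X) = 2048 / 2 ^ o' X" using o11[OF X] by (simp add: power_diff)
        then show ?thesis by simp
      qed
      finally show "(if X \<in> ?V then 2 ^ o' X else 1) * g ^ (count_list p1 X * l X) / 2 ^ (count_list p1 X * o' X)
          \<le> real_of_int (tab p2 X ! (l X - 1) * 2 ^ (11 - o' X)) / 2048000" .
      show "0 \<le> (if X \<in> ?V then 2 ^ o' X else 1) * g ^ (count_list p1 X * l X) / 2 ^ (count_list p1 X * o' X)"
        using g by simp
    qed (use \<pi>[of e] \<pi>[of q] in auto)
    also have "\<dots> = run_value l p2 \<pi> ?ps [] q q / (2048000 ^ ?k * \<pi> q)"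
    proof -
      have "run_value l p2 \<pi> ?ps [] q q = \<pi> e * (\<Prod>X\<in>set (p1 @ p2). tab p2 X ! (l X - 1) * 2 ^ (11 - o' X))"
        unfolding e_def o'_def by (rule run_value_full[OF u]) (use len l14 in \<open>auto simp: p\<close>)
      then show ?thesis by (simp only: p of_int_mult of_int_prod prod_dividef prod_constant) simp
    qed
    finally show ?thesis .
  qed
  have "wprod P0 n \<le> card (good P0 n)" for n
  proof (rule card_good_ge)
    fix q n
    let ?S = "search p2 \<pi> ?ps [] q q"
    have "(\<Sum>l\<in>shapes q n. free_words q l / wprod q (len l p1)) = (\<Sum>l\<in>PiE (set p) (\<lambda>_. {1..n}). H q l)"
      unfolding shapes_def H_def by (rule sum.inter_filter) (auto intro: finite_PiE)
    also have "\<dots> \<le> (1 / (1 - Q)) ^ ?k * (\<Sum>l\<in>PiE (set p) (\<lambda>_. {1..14}). H q l)"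
      by (rule sum_PiE_periodic_le) (use H_nn H_shift in \<open>auto simp: Q_def g_def power_divide\<close>)
    also have "\<dots> \<le> (2011/2000) ^ ?k * (\<Sum>l\<in>PiE (set p) (\<lambda>_. {1..14}).
        run_value l p2 \<pi> ?ps [] q q / (2048000 ^ ?k * \<pi> q))"
      by (intro mult_mono power_mono sum_mono H_le sum_nonneg H_nn) (auto simp: Q_def g_def power_divide)
    also have "\<dots> = (2011/2000) ^ ?k * (real_of_int ?S / (2048000 ^ ?k * \<pi> q))"
    proof -
      have "{x. Some x \<in> set ?ps} - fst ` set ([] :: (nat \<times> phase \<times> phase) list) = set p" by (auto simp: p)
      then have "?S = (\<Sum>l\<in>PiE (set p) (\<lambda>_. {1..14}). run_value l p2 \<pi> ?ps [] q q)"
        by (simp only: search_eq_sum)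
      then show ?thesis by (simp only: of_int_sum sum_divide_distrib)
    qed
    also have "\<dots> = real_of_int (100 * 2011 ^ ?k * ?S) / (100 * 4096000000 ^ ?k * \<pi> q)"
    proof -
      have "(4096000000 :: real) ^ ?k = 2000 ^ ?k * 2048000 ^ ?k" by (simp flip: power_mult_distrib)
      then show ?thesis by (simp add: power_divide)
    qed
    also have "\<dots> \<le> real_of_int ((109 * \<pi> (nxt q) - 100 * \<pi> q) * 4096000000 ^ ?k) / (100 * 4096000000 ^ ?k * \<pi> q)"
      using chk[of q] \<pi>[of q] unfolding p by (intro divide_right_mono of_int_le_iff[THEN iffD2]) auto
    also have "\<dots> = card (C q) / wt q - 1"
      using \<pi>[of q] \<pi>[of "nxt q"] by (simp add: wt_def cardC g_def field_simps)
    finally show "(\<Sum>l\<in>shapes q n. free_words q l / wprod q (len l p1)) \<le> card (C q) / wt q - 1" .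
  qed (rule feasible)
  moreover have "card (good P0 n) \<le> growth_fun {..<3 :: nat} (avoiding_words {..<3} p) n" for n
    unfolding growth_fun_def
    by (rule card_mono[OF finite_lists_of_length good_subset_avoiding]) (auto simp: C_def)
  ultimately have 1: "wprod P0 n \<le> real (growth_fun {..<3 :: nat} (avoiding_words {..<3} p) n)" for n
    by (meson of_nat_le_iff order_trans)
  \<comment> \<open>Over whole periods the values of \<open>\<pi>\<close> cancel, leaving the growth
    \<open>2 ^ 11 / 1.09 ^ 14\<close> per period, which is at least
    \<open>1.58 ^ 14\<close>.\<close>
  have 2: "(79/50 :: real) ^ (14 * j) \<le> wprod P0 (14 * j)" for j
  proof -
    have "(79/50 :: real) ^ (14 * j) = ((79/50) ^ 14) ^ j" by (simp only: power_mult)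
    also have "\<dots> \<le> (2 ^ 11 / g ^ 14) ^ j" by (intro power_mono) (simp_all add: g_def power_divide)
    also have "\<dots> = wprod P0 (14 * j)"
      using \<pi>[of P0] ones_add_period[of P0 0 j] nxt_period_mult[of 0 j P0]
      by (simp add: wprod power_mult power_divide)
    finally show ?thesis .
  qed
  have "(79/50 :: real) ^ (14 * j) \<le> real (growth_fun {..<3 :: nat} (avoiding_words {..<3} p) (14 * j))" for j
    by (rule order_trans[OF 2 1])
  then show ?thesis unfolding p[symmetric] by (intro GR_ge[of 14]) auto
qed

subsection \<open>Patterns with at most five variables\<close>

definition phases :: "phase list" where
  "phases = [P0, P1, P2, P3, P4, P5, P6, P7, P8, P9, P10, P11, P12, P13]"

definition certified :: "nat list \<Rightarrow> nat list \<Rightarrow> (phase \<Rightarrow> int) \<Rightarrow> bool" where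
  "certified p1 p2 \<pi> \<longleftrightarrow> p1 \<noteq> [] \<and>
     list_all (\<lambda>X. count_list p1 X = (if X \<in> set p2 then 1 else 2)) (p1 @ p2) \<and>
     list_all (\<lambda>q. 0 < \<pi> q \<and>
       100 * 2011 ^ length (remdups (p1 @ p2)) * search p2 \<pi> (map Some p1 @ None # map Some p2) [] q q
       \<le> (109 * \<pi> (nxt q) - 100 * \<pi> q) * 4096000000 ^ length (remdups (p1 @ p2))) phases"

lemma GR_ge_certified:
  assumes "certified p1 p2 \<pi>"
  shows "79/50 \<le> GR 3 (p1 @ p2)"
proof -
  have ph: "q \<in> set phases" for q by (cases q) (simp_all add: phases_def)
  have len: "length (remdups (p1 @ p2)) = card (set (p1 @ p2))" by (rule length_remdups_card_conv)
  have *: "p1 \<noteq> []" "\<forall>X\<in>set (p1 @ p2). count_list p1 X = (if X \<in> set p2 then 1 else 2)"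
    "\<forall>q\<in>set phases. 0 < \<pi> q \<and>
       100 * 2011 ^ card (set (p1 @ p2)) * search p2 \<pi> (map Some p1 @ None # map Some p2) [] q q
       \<le> (109 * \<pi> (nxt q) - 100 * \<pi> q) * 4096000000 ^ card (set (p1 @ p2))"
    using assms unfolding certified_def list_all_iff len by blast+
  show ?thesis by (rule GR_ge_periodic[of \<pi>]) (use * ph in blast)+
qed

lemma GR_ge_rev:
  assumes "c \<le> GR k q'" and "rev q = map r q'" and "q' \<noteq> []"
  shows "c \<le> GR k q"
proof -
  have "q \<noteq> []" using assms(2,3) by auto
  then show ?thesis using GR_map_le[OF assms(3), of k r] GR_rev[of q k] assms(1,2) by simp
qed

lemma GR_ge_subst:
  assumes "c \<le> GR k q'" and "q = x @ concat (map \<sigma> q') @ y" and "q' \<noteq> []"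
    and "\<forall>X\<in>set q'. \<sigma> X \<noteq> []"
  shows "c \<le> GR k q"
  using GR_subst_le[OF assms(2,3), of k] assms(1,4) by simp

text \<open>The values of \<open>\<pi>\<close> below are rounded Perron eigenvectors.\<close>

lemma GR_ABACBC: "79/50 \<le> GR 3 [0 :: nat, 1, 0, 2, 1, 2]"
proof -
  have "certified [0, 1, 0, 2] [1, 2]
      (case_phase 84 78 73 88 126 121 116 112 107 102 109 101 95 90)"
    by code_simp
  from GR_ge_certified[OF this] show ?thesis by simp
qed

lemma GR_ABCACB: "79/50 \<le> GR 3 [0 :: nat, 1, 2, 0, 2, 1]"
proof -
  have "certified [0, 1, 2] [0, 2, 1]
      (case_phase 92 87 82 92 101 96 92 89 123 119 115 108 104 98)"
    by code_simp
  from GR_ge_certified[OF this] show ?thesis by simp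
qed

lemma GR_ABACBDCD: "79/50 \<le> GR 3 [0 :: nat, 1, 0, 2, 1, 3, 2, 3]"
proof -
  have "certified [0, 1, 0, 2, 1, 3] [2, 3]
      (case_phase 99 95 91 91 94 97 100 100 99 106 110 108 106 103)"
    by code_simp
  from GR_ge_certified[OF this] show ?thesis by simp
qed

lemma GR_ABCBADCD: "79/50 \<le> GR 3 [0 :: nat, 1, 2, 1, 0, 3, 2, 3]"
proof -
  have "certified [0, 1, 2, 1, 0, 3] [2, 3]
      (case_phase 194 194 199 185 184 185 187 187 211 229 229 214 204 198)"
    by code_simp
  from GR_ge_certified[OF this] show ?thesis by simp
qed

lemma GR_ABCACDBD: "79/50 \<le> GR 3 [0 :: nat, 1, 2, 0, 2, 3, 1, 3]"
proof -
  have "certified [0, 1, 2, 0, 2, 3] [1, 3]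
      (case_phase 99 98 96 97 97 96 98 100 105 106 105 103 101 100)"
    by code_simp
  from GR_ge_certified[OF this] show ?thesis by simp
qed

lemma GR_ABCADBDC: "79/50 \<le> GR 3 [0 :: nat, 1, 2, 0, 3, 1, 3, 2]"
proof -
  have "certified [0, 1, 2, 0, 3] [1, 3, 2]
      (case_phase 102 98 94 90 87 88 89 93 117 115 110 106 108 105)"
    by code_simp
  from GR_ge_certified[OF this] show ?thesis by simp
qed

lemma GR_ABCADCBD: "79/50 \<le> GR 3 [0 :: nat, 1, 2, 0, 3, 2, 1, 3]"
proof -
  have "certified [0, 1, 2, 0, 3] [2, 1, 3]
      (case_phase 89 84 78 79 114 114 112 110 110 107 107 103 99 95)"
    by code_simp
  from GR_ge_certified[OF this] show ?thesis by simp
qed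

lemma GR_ABCADCDB: "79/50 \<le> GR 3 [0 :: nat, 1, 2, 0, 3, 2, 3, 1]"
proof -
  have "certified [0, 1, 2, 0, 3] [2, 3, 1]
      (case_phase 101 99 96 97 97 98 99 101 102 102 99 98 106 105)"
    by code_simp
  from GR_ge_certified[OF this] show ?thesis by simp
qed

lemma GR_ABCBDADC: "79/50 \<le> GR 3 [0 :: nat, 1, 2, 1, 3, 0, 3, 2]"
proof -
  have "certified [0, 1, 2, 1, 3] [0, 3, 2]
      (case_phase 464 455 532 497 461 448 429 421 503 598 614 566 521 492)"
    by code_simp
  from GR_ge_certified[OF this] show ?thesis by simp
qed

lemma GR_ABACBDCEDE: "79/50 \<le> GR 3 [0 :: nat, 1, 0, 2, 1, 3, 2, 4, 3, 4]"
proof -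
  have "certified [0, 1, 0, 2, 1, 3, 2, 4] [3, 4]
      (case_phase 94 91 88 93 99 103 108 108 105 108 104 103 100 97)"
    by code_simp
  from GR_ge_certified[OF this] show ?thesis by simp
qed

lemma GR_ABACDBCEDE: "79/50 \<le> GR 3 [0 :: nat, 1, 0, 2, 3, 1, 2, 4, 3, 4]"
proof -
  have "certified [0, 1, 0, 2, 3, 1, 2, 4] [3, 4]
      (case_phase 98 93 89 93 97 99 102 103 104 108 102 105 104 103)"
    by code_simp
  from GR_ge_certified[OF this] show ?thesis by simp
qed

lemma GR_ABACDBDECE: "79/50 \<le> GR 3 [0 :: nat, 1, 0, 2, 3, 1, 3, 4, 2, 4]"
proof -
  have "certified [0, 1, 0, 2, 3, 1, 3, 4] [2, 4]
      (case_phase 99 94 89 88 88 89 93 102 111 112 112 111 108 104)"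
    by code_simp
  from GR_ge_certified[OF this] show ?thesis by simp
qed

section \<open>Patterns obtained by reversal or substitution\<close>

lemma GR_ABCBAC: "79/50 \<le> GR 3 [0 :: nat, 1, 2, 1, 0, 2]"
  by (rule GR_ge_rev[OF GR_ABCACB, where r = "(!) [2, 0, 1]"]) simp_all

lemma GR_ABACDBCD: "79/50 \<le> GR 3 [0 :: nat, 1, 0, 2, 3, 1, 2, 3]"
  by (rule GR_ge_subst[OF GR_ABACBC, where x = "[]" and \<sigma> = "(!) [[0], [1], [2, 3]]" and y = "[]"]) simp_all

lemma GR_ABACDBDC: "79/50 \<le> GR 3 [0 :: nat, 1, 0, 2, 3, 1, 3, 2]"
  by (rule GR_ge_rev[OF GR_ABCBADCD, where r = "(!) [2, 3, 1, 0]"]) simp_all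

lemma GR_ABACDCBD: "79/50 \<le> GR 3 [0 :: nat, 1, 0, 2, 3, 2, 1, 3]"
  by (rule GR_ge_rev[OF GR_ABCACDBD, where r = "(!) [3, 1, 2, 0]"]) simp_all

lemma GR_ABCABDCD: "79/50 \<le> GR 3 [0 :: nat, 1, 2, 0, 1, 3, 2, 3]"
  by (rule GR_ge_subst[OF GR_ABACBC, where x = "[]" and \<sigma> = "(!) [[0, 1], [2], [3]]" and y = "[]"]) simp_all

lemma GR_ABCADBCD: "79/50 \<le> GR 3 [0 :: nat, 1, 2, 0, 3, 1, 2, 3]"
  by (rule GR_ge_subst[OF GR_ABACBC, where x = "[]" and \<sigma> = "(!) [[0], [1, 2], [3]]" and y = "[]"]) simp_all

lemma GR_ABCBDACD: "79/50 \<le> GR 3 [0 :: nat, 1, 2, 1, 3, 0, 2, 3]"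
  by (rule GR_ge_rev[OF GR_ABCADBDC, where r = "(!) [3, 2, 0, 1]"]) simp_all

lemma GR_ABCBDCAD: "79/50 \<le> GR 3 [0 :: nat, 1, 2, 1, 3, 2, 0, 3]"
  by (rule GR_ge_rev[OF GR_ABCADCDB, where r = "(!) [3, 0, 2, 1]"]) simp_all

lemma GR_ABCBDCDA: "79/50 \<le> GR 3 [0 :: nat, 1, 2, 1, 3, 2, 3, 0]"
  by (rule GR_ge_subst[OF GR_ABACBC, where x = "[0]" and \<sigma> = "(!) [[1], [2], [3]]" and y = "[0]"]) simp_all

lemma GR_ABACDCBEDE: "79/50 \<le> GR 3 [0 :: nat, 1, 0, 2, 3, 2, 1, 4, 3, 4]"
  by (rule GR_ge_rev[OF GR_ABACDBDECE, where r = "(!) [4, 3, 1, 2, 0]"]) simp_all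

text \<open>Representatives, numbered by first occurrence, of the patterns left when neither a
  square nor the distinct-suffix criterion in either direction applies;
  \<open>double_words_settled\<close> confirms that none is missing.\<close>

definition residual :: "nat list list" where
  "residual =
   [[0, 1, 0, 2, 1, 2],
    [0, 1, 2, 0, 2, 1],
    [0, 1, 2, 1, 0, 2],
    [0, 1, 0, 2, 1, 3, 2, 3],
    [0, 1, 0, 2, 3, 1, 2, 3],
    [0, 1, 0, 2, 3, 1, 3, 2],
    [0, 1, 0, 2, 3, 2, 1, 3],
    [0, 1, 2, 0, 1, 3, 2, 3],
    [0, 1, 2, 0, 2, 3, 1, 3],
    [0, 1, 2, 0, 3, 1, 2, 3],
    [0, 1, 2, 0, 3, 1, 3, 2],
    [0, 1, 2, 0, 3, 2, 1, 3],
    [0, 1, 2, 0, 3, 2, 3, 1],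
    [0, 1, 2, 1, 0, 3, 2, 3],
    [0, 1, 2, 1, 3, 0, 2, 3],
    [0, 1, 2, 1, 3, 0, 3, 2],
    [0, 1, 2, 1, 3, 2, 0, 3],
    [0, 1, 2, 1, 3, 2, 3, 0],
    [0, 1, 0, 2, 1, 3, 2, 4, 3, 4],
    [0, 1, 0, 2, 3, 1, 2, 4, 3, 4],
    [0, 1, 0, 2, 3, 1, 3, 4, 2, 4],
    [0, 1, 0, 2, 3, 2, 1, 4, 3, 4]]"

lemma GR_residual: "list_all (\<lambda>q. 79/50 \<le> GR 3 q) residual"
  unfolding residual_def list.pred_inject(2)
  by (intro conjI list.pred_inject(1)
    GR_ABACBC GR_ABCACB GR_ABCBAC GR_ABACBDCD
    GR_ABACDBCD GR_ABACDBDC GR_ABACDCBD GR_ABCABDCD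
    GR_ABCACDBD GR_ABCADBCD GR_ABCADBDC GR_ABCADCBD
    GR_ABCADCDB GR_ABCBADCD GR_ABCBDACD GR_ABCBDADC
    GR_ABCBDCAD GR_ABCBDCDA GR_ABACBDCEDE GR_ABACDBCEDE
    GR_ABACDBDECE GR_ABACDCBEDE)

section \<open>Enumeration of patterns in which every variable occurs twice\<close>

fun has_square :: "'a list \<Rightarrow> bool" where
  "has_square [] = False"
| "has_square (a # w) = (has_square_prefix [] (a # w) \<or> has_square w)"

lemma has_square_sound: "has_square w \<Longrightarrow> \<exists>u. u \<noteq> [] \<and> sublist (u @ u) w"
proof (induction w)
  case (Cons a w)
  show ?case
  proof (cases "has_square w")
    case True
    then show ?thesis using Cons.IH by (metis sublist_Cons_right)
  next
    case False
    then have "has_square_prefix [] (a # w)" using Cons.prems by simp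
    then obtain v where "v \<noteq> []" "prefix (v @ v) (a # w)"
      using has_square_prefix_sound[of "[]" "a # w"] by (auto simp del: has_square_prefix.simps)
    then show ?thesis using prefix_imp_sublist by metis
  qed
qed simp

text \<open>Words in which each of \<open>k\<close> variables occurs twice, numbered by first occurrence: \<open>os\<close> contains the
  variables seen once, \<open>n\<close> is the number of variables seen.\<close>

fun double_words :: "nat \<Rightarrow> nat \<Rightarrow> nat list \<Rightarrow> nat \<Rightarrow> nat list list" where
  "double_words 0 k os n = [[]]"
| "double_words (Suc m) k os n =
     concat (map (\<lambda>x. map ((#) x) (double_words m k (remove1 x os) n)) os) @
     (if n < k then map ((#) n) (double_words m k (n # os) (Suc n)) else [])"

text \<open>The list \<open>vs\<close> names the variables read so far in order of first occurrence,
  and \<open>os\<close> holds indices of those awaiting their second one. Each remaining letter is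
  therefore either such a variable or new and due twice; \<open>vs'\<close> names the new
  ones.\<close>

lemma double_words_complete:
  fixes s vs :: "'v list"
  assumes "\<forall>y\<in>set s. (\<exists>i\<in>set os. i < length vs \<and> vs ! i = y \<and> count_list s y = 1) \<or>
      (y \<notin> set vs \<and> count_list s y = 2)"
    and "length vs + card (set s - set vs) \<le> k"
  shows "\<exists>q vs'. q \<in> set (double_words (length s) k os (length vs)) \<and> s = map ((!) (vs @ vs')) q"
  using assms
proof (induction s arbitrary: vs os)
  case (Cons x s)
  note inv = Cons.prems(1)
  show ?case
  proof (cases "x \<in> set vs")
    case True
    then obtain i where i: "i \<in> set os" "i < length vs" "vs ! i = x" "count_list (x # s) x = 1"
      using inv by auto
    then have xs: "x \<notin> set s" by (simp add: count_list_0_iff)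
    have inv': "\<forall>y\<in>set s. (\<exists>j\<in>set (remove1 i os). j < length vs \<and> vs ! j = y \<and> count_list s y = 1) \<or>
        (y \<notin> set vs \<and> count_list s y = 2)"
    proof
      fix y assume y: "y \<in> set s"
      then have "y \<noteq> x" using xs by auto
      then have c: "count_list (x # s) y = count_list s y" by simp
      consider j where "j \<in> set os" "j < length vs" "vs ! j = y" "count_list s y = 1"
        | "y \<notin> set vs" "count_list s y = 2"
        using inv y c by (metis list.set_intros(2))
      then show "(\<exists>j\<in>set (remove1 i os). j < length vs \<and> vs ! j = y \<and> count_list s y = 1) \<or>
        (y \<notin> set vs \<and> count_list s y = 2)"
      proof cases
        case 1
        then have "j \<in> set (remove1 i os)" using i(3) \<open>y \<noteq> x\<close> by (metis in_set_remove1)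
        then show ?thesis using 1 by blast
      qed simp
    qed
    have "set (x # s) - set vs = set s - set vs" using True by auto
    then have "length vs + card (set s - set vs) \<le> k" using Cons.prems(2) by simp
    from Cons.IH[OF inv' this] obtain q vs' where
      q: "q \<in> set (double_words (length s) k (remove1 i os) (length vs))" "s = map ((!) (vs @ vs')) q"
      by blast
    have "x # s = map ((!) (vs @ vs')) (i # q)" using q(2) i(2,3) by (simp add: nth_append)
    moreover have "i # q \<in> set (double_words (length (x # s)) k os (length vs))"
      using q(1) i(1) by auto
    ultimately show ?thesis by metis
  next
    case False
    then have cx: "count_list s x = 1" using inv by auto
    have inv': "\<forall>y\<in>set s. (\<exists>j\<in>set (length vs # os). j < length (vs @ [x]) \<and> (vs @ [x]) ! j = y \<and> count_list s y = 1) \<or>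
        (y \<notin> set (vs @ [x]) \<and> count_list s y = 2)"
    proof
      fix y assume y: "y \<in> set s"
      show "(\<exists>j\<in>set (length vs # os). j < length (vs @ [x]) \<and> (vs @ [x]) ! j = y \<and> count_list s y = 1) \<or>
        (y \<notin> set (vs @ [x]) \<and> count_list s y = 2)"
      proof (cases "y = x")
        case True
        then show ?thesis using cx by simp
      next
        case False
        then have c: "count_list (x # s) y = count_list s y" by simp
        consider j where "j \<in> set os" "j < length vs" "vs ! j = y" "count_list s y = 1"
          | "y \<notin> set vs" "count_list s y = 2"
          using inv y c by (metis list.set_intros(2))
        then show ?thesis
        proof cases
          case 1
          then show ?thesis by (intro disjI1 bexI[of _ j]) (auto simp: nth_append)
        qed (use False in simp)
      qed
    qed
    have d: "card (set (x # s) - set vs) = Suc (card (set s - set (vs @ [x])))"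
    proof -
      have "set (x # s) - set vs = insert x (set s - set (vs @ [x]))" using False by auto
      then show ?thesis by simp
    qed
    have "length (vs @ [x]) + card (set s - set (vs @ [x])) \<le> k" using d Cons.prems(2) by simp
    from Cons.IH[OF inv' this] obtain q vs' where
      q: "q \<in> set (double_words (length s) k (length vs # os) (length (vs @ [x])))"
        "s = map ((!) ((vs @ [x]) @ vs')) q"
      by blast
    have "x # s = map ((!) (vs @ (x # vs'))) (length vs # q)" using q(2) by simp
    moreover have "length vs # q \<in> set (double_words (length (x # s)) k os (length vs))"
      using q(1) d Cons.prems(2) by simp
    ultimately show ?thesis by metis
  qed
qed simp

definition distinct_suffix_case :: "nat list \<Rightarrow> bool" where
  "distinct_suffix_case q \<longleftrightarrow> list_all (\<lambda>X. count_list q X = 2) q \<and>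
     (length q = 8 \<and> length (remdups q) = 4 \<and> distinct (drop 4 q) \<or>
      length q = 10 \<and> length (remdups q) = 5 \<and> distinct (drop 7 q))"

lemma GR_ge_distinct_suffix_case:
  assumes "distinct_suffix_case q"
  shows "79/50 \<le> GR 3 q"
proof -
  have two: "count_list q X = 2" if "X \<in> set q" for X
    using assms that by (simp add: distinct_suffix_case_def list_all_iff)
  have "\<beta> \<le> GR 3 q"
    if "distinct (drop n q)" "n < length q" "\<beta> > 0" "3 / \<beta>\<^sup>2 < 1"
      "(1 / (\<beta> - 1)) ^ (length q - n) * (3 / (\<beta>\<^sup>2 - 3)) ^ (card (set q) - (length q - n)) \<le> 3 / \<beta> - 1"
    for n \<beta>
    using GR_ge_distinct_suffix[of "take n q" "drop n q" \<beta>] two that by simp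
  \<comment> \<open>With all four variables in the last four places the inequality reads
    \<open>(5/8) ^ 4 \<le> 2/13\<close>. With three of five variables in the last three places the
    rate 277/100 suffices. Both rates exceed 79/50.\<close>
  from this[of 4 "13/5"] this[of 7 "277/100"] assms show ?thesis
    by (auto simp: distinct_suffix_case_def length_remdups_card_conv power2_eq_square power_divide eval_nat_numeral)
qed

definition settled :: "nat list \<Rightarrow> bool" where
  "settled q \<longleftrightarrow> has_square q \<or> distinct_suffix_case q \<or> distinct_suffix_case (rev q) \<or> q \<in> set residual"

lemma double_words_settled:
  "list_all settled (double_words 6 3 [] 0)"
  "list_all settled (double_words 8 4 [] 0)"
  "list_all settled (double_words 10 5 [] 0)"
  by code_simp+

theorem theorem4:
  fixes p :: "'v list" and A :: 'v
  assumes "p \<noteq> []" and "doubled p"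
  shows "GR 3 p \<ge> GR 3 [A, A]"
proof (cases "\<exists>u. u \<noteq> [] \<and> sublist (u @ u) p")
  case True
  then obtain u where "u \<noteq> []" "sublist (u @ u) p" by auto
  then show ?thesis using GR_square_le by metis
next
  case sqf: False
  have dbl: "count_list p X \<ge> 2" if "X \<in> set p" for X using assms(2) that by (simp add: doubled_def)
  have len: "length p = (\<Sum>X\<in>set p. count_list p X)" by (simp add: sum_count_set)
  then have len2: "2 * card (set p) \<le> length p"
    using sum_mono[of "set p" "\<lambda>_. 2" "count_list p"] dbl by simp
  have sq: False if "p = x @ u @ u @ y" "u \<noteq> []" for x u y
    using sqf that by (metis append.assoc sublist_appendI)
  \<comment> \<open>Neighbouring letters differ, so a pattern on at most two variables alternates;
    being doubled, it would contain a square \<open>a a\<close> or \<open>a b a b\<close>.\<close>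
  have k3: "3 \<le> card (set p)"
  proof (rule ccontr)
    assume "\<not> 3 \<le> card (set p)"
    then have k2: "card (set p) \<le> 2" by simp
    have "card (set p) \<ge> 1" using assms(1) by (simp add: Suc_le_eq card_gt_0_iff)
    then obtain a b r where p: "p = a # b # r" using len2 by (cases p; cases "tl p") auto
    have ab: "a \<noteq> b" using sq[of "[]" "[a]" r] p by auto
    then have "card {a, b} = 2" by simp
    then have ab2: "set p = {a, b}" using k2 p
      by (metis card_seteq finite_set insert_subset list.set_intros(1,2) empty_subsetI)
    then obtain c d r' where r: "r = c # d # r'" using len2 p \<open>card {a, b} = 2\<close>
      by (cases r; cases "tl r") auto
    have "b \<noteq> c" using sq[of "[a]" "[b]" "d # r'"] p r by auto
    moreover have "c \<noteq> d" using sq[of "[a, b]" "[c]" r'] p r by auto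
    moreover have "c \<in> {a, b}" "d \<in> {a, b}" using ab2 p r by auto
    ultimately have "c = a" "d = b" by auto
    then show False using sq[of "[]" "[a, b]" r'] p r by simp
  qed
  have "79/50 \<le> GR 3 p"
  proof (cases "6 \<le> card (set p) \<or> (\<exists>X. 3 \<le> count_list p X)")
    case True
    then have "14/5 \<le> GR 3 p" using k3 by (intro GR_ge_doubled assms) auto
    then show ?thesis by simp
  next
    case False
    \<comment> \<open>In the remaining case every variable occurs exactly twice, and
      \<open>p\<close> is a renaming of an enumerated word with three to five variables.\<close>
    then have two: "count_list p X = 2" if "X \<in> set p" for X
      using dbl[OF that] by (metis le_antisym not_less_eq_eq numeral_2_eq_2 numeral_3_eq_3)
    then have "length p = 2 * card (set p)" using len by simp
    moreover obtain q vs where q: "q \<in> set (double_words (length p) (card (set p)) [] 0)"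
      and p: "p = map ((!) vs) q"
      using double_words_complete[of p "[]" "[]" "card (set p)"] two by auto
    moreover have "card (set p) \<in> {3, 4, 5}" using False k3 by auto
    ultimately have "settled q"
      using double_words_settled by (auto simp: list_all_iff)
    \<comment> \<open>The renaming by \<open>vs\<close> maps a square in \<open>q\<close> to a
      square in \<open>p\<close>.\<close>
    moreover have "\<not> has_square q"
    proof
      assume "has_square q"
      then obtain u where "u \<noteq> []" "sublist (u @ u) q" using has_square_sound by auto
      then have "sublist (map ((!) vs) u @ map ((!) vs) u) p" "map ((!) vs) u \<noteq> []"
        using map_mono_sublist[of "u @ u" q "(!) vs"] p by auto
      then show False using sqf by metis
    qed
    ultimately consider "distinct_suffix_case q" | "distinct_suffix_case (rev q)" | "q \<in> set residual" by (auto simp: settled_def)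
    then have "79/50 \<le> GR 3 q"
    proof cases
      case 2
      then have "79/50 \<le> GR 3 (rev q)" by (rule GR_ge_distinct_suffix_case)
      then show ?thesis using GR_rev[of q 3] assms(1) p by simp
    qed (use GR_ge_distinct_suffix_case GR_residual in \<open>auto simp: list_all_iff\<close>)
    also have "\<dots> \<le> GR 3 p" unfolding p using assms(1) p by (intro GR_map_le) auto
    finally show ?thesis .
  qed
  \<comment> \<open>The value 79/50 separates the two growth rates.\<close>
  then show ?thesis using GR_AA_le[of A] by linarith
qed

end
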